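(* Let $G$ be a connected $k$-regular graph of even order satisfying $k\geq \frac{6}{7}|V(G)|$. Then $rd(G)=k$.
   Context: All graphs are simple, finite and undirected. For an edge-coloring of $G$ (adjacent edges may receive the same color), an edge-cut $R$ is a rainbow cut if no two edges of $R$ have the same color; it is a $u$-$v$ rainbow cut if $u$ and $v$ lie in different components of $G-R$. $G$ is rainbow disconnected if every two vertices $u,v$ have a $u$-$v$ rainbow cut. For a nontrivial connected graph $G$, $rd(G)$ is the smallest number of colors in an edge-coloring making $G$ rainbow disconnected. *)

theory Defs
  imports Complex_Main
begin

text \<open>A graph is given by its vertex set and its edge set, where an edge is the two-element set of
  its endpoints.\<close>

definition simple_graph :: "'a set \<Rightarrow> 'a set set \<Rightarrow> bool" where
  "simple_graph V E \<longleftrightarrow> finite V \<and> (\<forall>e\<in>E. e \<subseteq> V \<and> card e = 2)"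

definition degree :: "'a set set \<Rightarrow> 'a \<Rightarrow> nat" where
  "degree E v = card {e \<in> E. v \<in> e}"

definition regular :: "nat \<Rightarrow> 'a set \<Rightarrow> 'a set set \<Rightarrow> bool" where
  "regular k V E \<longleftrightarrow> (\<forall>v\<in>V. degree E v = k)"

definition adj_rel :: "'a set set \<Rightarrow> ('a \<times> 'a) set" where
  "adj_rel E = {(x, y). {x, y} \<in> E}"

definition component :: "'a set \<Rightarrow> 'a set set \<Rightarrow> 'a \<Rightarrow> 'a set" where
  "component V E v = {w \<in> V. (v, w) \<in> (adj_rel E)\<^sup>*}"

definition connected_graph :: "'a set \<Rightarrow> 'a set set \<Rightarrow> bool" where
  "connected_graph V E \<longleftrightarrow> V \<noteq> {} \<and> (\<forall>v\<in>V. component V E v = V)"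

definition edge_cut :: "'a set \<Rightarrow> 'a set set \<Rightarrow> 'a set set \<Rightarrow> bool" where
  "edge_cut V E R \<longleftrightarrow> R \<subseteq> E \<and> \<not> connected_graph V (E - R)"

text \<open>An edge-coloring is an arbitrary function on edges; adjacent edges may share a color, and only
  the values on \<open>E\<close> matter.\<close>

definition rainbow_cut :: "'a set \<Rightarrow> 'a set set \<Rightarrow> ('a set \<Rightarrow> nat) \<Rightarrow> 'a set set \<Rightarrow> bool" where
  "rainbow_cut V E c R \<longleftrightarrow> edge_cut V E R \<and> inj_on c R"

definition uv_rainbow_cut ::
    "'a set \<Rightarrow> 'a set set \<Rightarrow> ('a set \<Rightarrow> nat) \<Rightarrow> 'a \<Rightarrow> 'a \<Rightarrow> 'a set set \<Rightarrow> bool" where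
  "uv_rainbow_cut V E c u v R \<longleftrightarrow>
     rainbow_cut V E c R \<and> component V (E - R) u \<noteq> component V (E - R) v"

definition rainbow_disconnected :: "'a set \<Rightarrow> 'a set set \<Rightarrow> ('a set \<Rightarrow> nat) \<Rightarrow> bool" where
  "rainbow_disconnected V E c \<longleftrightarrow>
     (\<forall>u\<in>V. \<forall>v\<in>V. u \<noteq> v \<longrightarrow> (\<exists>R. uv_rainbow_cut V E c u v R))"

text \<open>The set minimized over is nonempty for every finite graph: any coloring injective on \<open>E\<close> is
  rainbow disconnected with \<open>R = E\<close>.\<close>

definition rd :: "'a set \<Rightarrow> 'a set set \<Rightarrow> nat" where
  "rd V E = (LEAST n. \<exists>c. rainbow_disconnected V E c \<and> card (c ` E) = n)"

end

theory Submission
  imports Defs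
begin

text \<open>A proper coloring with \<open>k\<close> colors makes the edges at each vertex a rainbow cut, and since
  \<open>2 k \<ge> |V|\<close> every cut has at least \<open>k\<close> edges; so the point is that \<open>E\<close> is 1-factorizable
  (Chetwynd and Hilton).

  Let \<open>r = |V| - 1 - k\<close>, so \<open>7 (r + 1) \<le> |V|\<close>. By parity a \<open>k\<close>-edge-coloring of \<open>E - w\<close>
  always extends to \<open>w\<close>. Vizing's adjacency lemma lets one delete further vertices: \<open>a\<close> can be
  deleted if it has at most \<open>s\<close> neighbours of full degree \<open>D\<close> and enough neighbours of degree at
  most \<open>D - s\<close>; once no vertex of degree \<open>D\<close> is left we are done.

  Choose nonadjacent \<open>w\<close>, \<open>b\<close> and let \<open>C\<close> be the set of at most \<open>2 r - 2\<close> other vertices not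
  adjacent to both. By Dirac's theorem one can split off \<open>|C| + 2\<close> matchings through
  prescribed edges. Some of them are perfect and make the neighbourhoods of \<open>w\<close> and \<open>b\<close> equal to
  the complement of \<open>C\<close>; the others cover all vertices but \<open>w\<close> and \<open>b\<close>. Then \<open>b\<close> can be
  deleted after \<open>w\<close>, and exactly the vertices of \<open>C\<close> remain full. The prescribed edges also cut
  off about \<open>|C| / 4\<close> chosen vertices outside \<open>C\<close> from \<open>C\<close>, up to at most four kept
  neighbours each, in such a way that deleting these vertices leaves no full vertex.\<close>

text \<open>Parity lets only one vertex go for free: without \<open>w\<close> its \<open>r\<close>
  nonneighbors are still full. A second vertex \<open>b\<close> can follow at once if all its
  neighbors are neighbors of \<open>w\<close>, since each of them has then lost an edge; hence the
  effort to make the two neighborhoods equal. Only few edges at \<open>w\<close> and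
  \<open>b\<close> may be spent on this, while each chosen vertex must meet almost all of
  \<open>C\<close>, so most matchings have to avoid \<open>w\<close> and \<open>b\<close>.

  The constant 7 is where two costs meet. Deleting \<open>w\<close>, \<open>b\<close> and two
  vertices without neighbors in \<open>C\<close> takes four edges from most vertices, so four kept
  neighbors are affordable. The exceptions number about \<open>2 r\<close>; together with the full
  vertices they must fit into the remaining colors, which for \<open>|C| \<le> 2 r - 2\<close> comes
  to exactly \<open>7 (r + 1) \<le> |V|\<close>. Splitting off the matchings costs about
  \<open>2 (r + |C| + |C| / 4)\<close>, again \<open>7 r\<close>. With a third vertex cut off
  completely from \<open>C\<close> the first cost would grow to about \<open>8 r\<close>, with only
  one such vertex the second would exceed \<open>7 r\<close>.\<close>

section \<open>Edge sets, degrees and proper colorings\<close>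

text \<open>A simple graph without its vertex set: the condition passes to every set of fewer edges,
  and a deleted vertex is just one of degree 0.\<close>

definition two_uniform :: "'a set set \<Rightarrow> bool" where
  "two_uniform E \<longleftrightarrow> finite E \<and> (\<forall>e\<in>E. card e = 2)"

definition nbrs :: "'a set set \<Rightarrow> 'a \<Rightarrow> 'a set" where
  "nbrs E v = {u. {v, u} \<in> E}"

definition proper_coloring :: "'a set set \<Rightarrow> ('a set \<Rightarrow> nat) \<Rightarrow> bool" where
  "proper_coloring E c \<longleftrightarrow> (\<forall>e\<in>E. \<forall>f\<in>E. e \<noteq> f \<longrightarrow> e \<inter> f \<noteq> {} \<longrightarrow> c e \<noteq> c f)"

definition edge_colorable :: "nat \<Rightarrow> 'a set set \<Rightarrow> bool" where
  "edge_colorable k E \<longleftrightarrow> (\<exists>c. proper_coloring E c \<and> c ` E \<subseteq> {..<k})"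

definition missing :: "nat \<Rightarrow> 'a set set \<Rightarrow> ('a set \<Rightarrow> nat) \<Rightarrow> 'a \<Rightarrow> nat set" where
  "missing D E c v = {i. i < D \<and> (\<forall>e\<in>E. v \<in> e \<longrightarrow> c e \<noteq> i)}"

lemma two_uniform_subset: "two_uniform E \<Longrightarrow> F \<subseteq> E \<Longrightarrow> two_uniform F"
  unfolding two_uniform_def by (auto intro: finite_subset)

lemma two_uniform_edgeE:
  assumes "two_uniform E" "e \<in> E" "v \<in> e"
  obtains u where "e = {v, u}" "u \<noteq> v"
proof -
  have "card e = 2" using assms unfolding two_uniform_def by auto
  then obtain a b where "e = {a, b}" "a \<noteq> b" by (auto simp: card_2_iff)
  with assms(3) that show thesis by (auto simp: insert_commute)
qed

lemma two_uniform_neq: "two_uniform E \<Longrightarrow> {v, u} \<in> E \<Longrightarrow> v \<noteq> u"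
  unfolding two_uniform_def by fastforce

lemma in_nbrs [simp]: "u \<in> nbrs E v \<longleftrightarrow> {v, u} \<in> E"
  by (simp add: nbrs_def)

lemma bij_betw_nbrs:
  assumes "two_uniform E"
  shows "bij_betw (\<lambda>u. {v, u}) (nbrs E v) {e \<in> E. v \<in> e}"
  unfolding bij_betw_def
proof
  show "inj_on (\<lambda>u. {v, u}) (nbrs E v)"
    by (auto simp: inj_on_def doubleton_eq_iff)
  show "(\<lambda>u. {v, u}) ` nbrs E v = {e \<in> E. v \<in> e}"
  proof (intro equalityI subsetI)
    fix e assume "e \<in> {e \<in> E. v \<in> e}"
    then obtain u where "e = {v, u}" "e \<in> E" using two_uniform_edgeE[OF assms, of e v] by auto
    then show "e \<in> (\<lambda>u. {v, u}) ` nbrs E v" by (auto simp: nbrs_def)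
  qed (auto simp: nbrs_def)
qed

lemma finite_nbrs: "two_uniform E \<Longrightarrow> finite (nbrs E v)"
  using bij_betw_finite[OF bij_betw_nbrs[of E v]] by (simp add: two_uniform_def)

lemma degree_eq_card_nbrs: "two_uniform E \<Longrightarrow> degree E v = card (nbrs E v)"
  unfolding degree_def using bij_betw_same_card[OF bij_betw_nbrs] by metis

lemma degree_mono: "two_uniform E \<Longrightarrow> F \<subseteq> E \<Longrightarrow> degree F v \<le> degree E v"
  unfolding degree_def two_uniform_def by (intro card_mono) auto

lemma degree_less:
  assumes "two_uniform E" "F \<subseteq> E" "e \<in> E" "e \<notin> F" "v \<in> e"
  shows "degree F v < degree E v"
  unfolding degree_def
proof (rule psubset_card_mono)
  show "finite {e \<in> E. v \<in> e}" using assms(1) by (simp add: two_uniform_def)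
  show "{e \<in> F. v \<in> e} \<subset> {e \<in> E. v \<in> e}"
  proof
    show "{e \<in> F. v \<in> e} \<subseteq> {e \<in> E. v \<in> e}" using assms(2) by auto
    show "{e \<in> F. v \<in> e} \<noteq> {e \<in> E. v \<in> e}"
    proof
      assume eq: "{e \<in> F. v \<in> e} = {e \<in> E. v \<in> e}"
      have "e \<in> {e \<in> E. v \<in> e}" using assms(3,5) by simp
      then have "e \<in> {e \<in> F. v \<in> e}" unfolding eq .
      then show False using assms(4) by simp
    qed
  qed
qed

lemma proper_coloringD:
  "proper_coloring E c \<Longrightarrow> e \<in> E \<Longrightarrow> f \<in> E \<Longrightarrow> v \<in> e \<Longrightarrow> v \<in> f \<Longrightarrow> c e = c f \<Longrightarrow> e = f"
  unfolding proper_coloring_def by blast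

lemma proper_coloring_upd:
  assumes "proper_coloring E c" "\<And>e'. e' \<in> E \<Longrightarrow> e' \<inter> e \<noteq> {} \<Longrightarrow> c e' \<noteq> \<beta>"
  shows "proper_coloring (insert e E) (c(e := \<beta>))"
  using assms unfolding proper_coloring_def
  by (auto simp: Int_commute)

lemma edge_colorable_subset:
  "edge_colorable k E \<Longrightarrow> F \<subseteq> E \<Longrightarrow> edge_colorable k F"
  unfolding edge_colorable_def proper_coloring_def by (meson image_mono subset_eq)

lemma finite_missing [simp]: "finite (missing D E c v)"
  unfolding missing_def by simp

lemma card_missing:
  assumes "two_uniform E" "proper_coloring E c" "c ` E \<subseteq> {..<D}"
  shows "card (missing D E c v) + degree E v = D"
proof -
  let ?S = "{e \<in> E. v \<in> e}"
  have "inj_on c ?S"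
    using proper_coloringD[OF assms(2)] by (auto simp: inj_on_def)
  then have "degree E v = card (c ` ?S)"
    by (simp add: degree_def card_image)
  moreover have "missing D E c v = {..<D} - c ` ?S"
    using assms(3) unfolding missing_def by auto
  moreover have "c ` ?S \<subseteq> {..<D}" using assms(3) by auto
  ultimately show ?thesis
    using card_mono[of "{..<D}" "c ` ?S"] by (simp add: card_Diff_subset finite_subset[of _ "{..<D}"])
qed

section \<open>Kempe chains\<close>

lemma adj_rel_sym: "(a, b) \<in> (adj_rel S)\<^sup>* \<Longrightarrow> (b, a) \<in> (adj_rel S)\<^sup>*"
proof -
  have "sym (adj_rel S)" by (auto simp: sym_def adj_rel_def insert_commute)
  then show "(a, b) \<in> (adj_rel S)\<^sup>* \<Longrightarrow> (b, a) \<in> (adj_rel S)\<^sup>*"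
    by (meson sym_rtrancl symE)
qed

lemma adj_rel_first_step:
  assumes "(x, y) \<in> (adj_rel S)\<^sup>*" "x \<noteq> y"
  obtains u where "{x, u} \<in> S"
  using assms(1)
proof (cases rule: converse_rtranclE)
  case (step u)
  with that show thesis by (simp add: adj_rel_def)
qed (use assms(2) in simp)

text \<open>A connected graph of maximum degree 2 is a path or a cycle, so at most two of its
  vertices have degree at most 1. Formally, the edge at \<open>x\<close> is deleted and its other
  end \<open>u\<close> takes over the role of \<open>x\<close>.\<close>

lemma path_has_two_ends:
  assumes "two_uniform S" "\<And>v. degree S v \<le> 2"
    and "degree S x \<le> 1" "degree S y \<le> 1" "degree S z \<le> 1"
    and "x \<noteq> y" "x \<noteq> z" "y \<noteq> z"
    and "(x, y) \<in> (adj_rel S)\<^sup>*" "(x, z) \<in> (adj_rel S)\<^sup>*"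
  shows False
  using assms
proof (induction "card S" arbitrary: S x y z rule: less_induct)
  case less
  obtain u where xu: "{x, u} \<in> S"
    using adj_rel_first_step[OF less.prems(9,6)] .
  have fin: "finite S" using less.prems(1) by (simp add: two_uniform_def)
  have "x \<noteq> u" using two_uniform_neq[OF less.prems(1) xu] .
  define S' where "S' = S - {{x, u}}"
  have S': "two_uniform S'" "card S' < card S"
    using less.prems(1) xu fin
    by (auto simp: S'_def intro: two_uniform_subset card_Diff1_less simp del: card_Diff_insert)
  have deg_le: "degree S' v \<le> degree S v" for v
    using degree_mono[OF less.prems(1)] by (simp add: S'_def)
  have deg_less: "degree S' v < degree S v" if "v \<in> {x, u}" for v
    by (rule degree_less[OF less.prems(1) _ xu]) (use that in \<open>auto simp: S'_def\<close>)
  have step: "v = x \<or> (u, v) \<in> (adj_rel S')\<^sup>*" if "(x, v) \<in> (adj_rel S)\<^sup>*" for v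
    using that
  proof (induction rule: rtrancl_induct)
    case (step v v')
    show ?case
    proof (cases "v = x")
      case True
      have "e = {x, u}" if "e \<in> S" "x \<in> e" for e
      proof (rule ccontr)
        assume "e \<noteq> {x, u}"
        then have "card {e, {x, u}} = 2" by simp
        moreover have "{e, {x, u}} \<subseteq> {e \<in> S. x \<in> e}" using that xu by auto
        ultimately have "2 \<le> degree S x" unfolding degree_def
          using card_mono[of "{e \<in> S. x \<in> e}" "{e, {x, u}}"] fin by simp
        with less.prems(3) show False by simp
      qed
      with True step have "{x, v'} = {x, u}" by (auto simp: adj_rel_def)
      then have "v' = u" using \<open>x \<noteq> u\<close> by (auto simp: doubleton_eq_iff)
      then show ?thesis by simp
    next
      case False
      show ?thesis
      proof (cases "v' = x")
        case False
        then have "(v, v') \<in> adj_rel S'"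
          using step(2) \<open>v \<noteq> x\<close> by (auto simp: adj_rel_def S'_def doubleton_eq_iff)
        with step \<open>v \<noteq> x\<close> show ?thesis by (meson rtrancl.rtrancl_into_rtrancl)
      qed simp
    qed
  qed simp
  have uy: "(u, y) \<in> (adj_rel S')\<^sup>*" and uz: "(u, z) \<in> (adj_rel S')\<^sup>*"
    using step less.prems by blast+
  have isolated: False if "degree S' u = 0" "(u, v) \<in> (adj_rel S')\<^sup>*" "u \<noteq> v" for v
  proof -
    from that(2,3) obtain t where "{u, t} \<in> S'"
      by (rule adj_rel_first_step)
    then have "{e \<in> S'. u \<in> e} \<noteq> {}" by auto
    moreover have "finite {e \<in> S'. u \<in> e}" using fin by (simp add: S'_def)
    ultimately show False using that(1) unfolding degree_def by (metis card_0_eq)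
  qed
  \<comment> \<open>If \<open>u\<close> is already \<open>y\<close> or \<open>z\<close>, it has lost
    its only edge and cannot reach the other one.\<close>
  show False
  proof (cases "u = y \<or> u = z")
    case True
    then have "degree S' u = 0" using deg_less[of u] less.prems(4,5) by auto
    with isolated uy uz True less.prems(8) show False by blast
  next
    case False
    have "degree S' v \<le> 2" for v using deg_le[of v] less.prems(2)[of v] by simp
    moreover have "degree S' u \<le> 1" using deg_less[of u] less.prems(2)[of u] by simp
    moreover have "degree S' y \<le> 1" "degree S' z \<le> 1"
      using deg_le[of y] deg_le[of z] less.prems(4,5) by auto
    ultimately show False
      using less.hyps[OF S'(2) S'(1), of u y z] False uy uz less.prems(8) by auto
  qed
qed

text \<open>Exchanging two colors on a whole component of their union keeps the coloring proper. The
  conclusions are what a fan centered outside \<open>K\<close> needs to survive: its edges keep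
  their colors, and a missing color can stop being missing only inside \<open>K\<close> and only if
  it is \<open>\<beta>\<close> or \<open>\<gamma>\<close>.\<close>

lemma kempe_swap:
  assumes "two_uniform E" "proper_coloring E c" "c ` E \<subseteq> {..<D}" "\<beta> < D" "\<gamma> < D"
    and K_def: "K = {u. (v, u) \<in> (adj_rel {e \<in> E. c e \<in> {\<beta>, \<gamma>}})\<^sup>*}"
  obtains c' where "proper_coloring E c'" "c' ` E \<subseteq> {..<D}"
    "\<And>u. u \<notin> K \<Longrightarrow> missing D E c' u = missing D E c u"
    "\<And>u i. i \<in> missing D E c u \<Longrightarrow> i \<noteq> \<beta> \<Longrightarrow> i \<noteq> \<gamma> \<Longrightarrow> i \<in> missing D E c' u"
    "\<gamma> \<in> missing D E c v \<Longrightarrow> \<beta> \<in> missing D E c' v"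
    "\<And>e u. e \<in> E \<Longrightarrow> u \<in> e \<Longrightarrow> u \<notin> K \<Longrightarrow> c' e = c e"
proof -
  define S where "S = {e \<in> E. c e \<in> {\<beta>, \<gamma>}}"
  define sw where "sw i = (if i = \<beta> then \<gamma> else if i = \<gamma> then \<beta> else i)" for i
  define c' where "c' e = (if e \<inter> K \<noteq> {} then sw (c e) else c e)" for e
  have sub: "e \<subseteq> K" if "e \<in> S" "e \<inter> K \<noteq> {}" for e
  proof
    fix t assume "t \<in> e"
    from that(2) obtain s where s: "s \<in> e" "s \<in> K" by auto
    show "t \<in> K"
    proof (cases "s = t")
      case False
      have "e = {s, t}"
        using s \<open>t \<in> e\<close> False two_uniform_edgeE[OF assms(1), of e s] that(1)
        by (auto simp: S_def)
      then have "(s, t) \<in> adj_rel S" using that(1) by (simp add: adj_rel_def)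
      then show ?thesis using s(2) unfolding K_def S_def[symmetric]
        by (auto intro: rtrancl_into_rtrancl)
    qed (use s in simp)
  qed
  have swinj: "sw i = sw j \<longleftrightarrow> i = j" for i j by (auto simp: sw_def)
  have c'K: "c' e = sw (c e)" if "e \<in> E" "u \<in> e" "u \<in> K" for e u
    using that by (auto simp: c'_def)
  have c'nK: "c' e = c e" if "e \<in> E" "u \<in> e" "u \<notin> K" for e u
  proof (cases "e \<in> S")
    case True
    then have "e \<inter> K = {}" using sub[of e] that by auto
    then show ?thesis by (simp add: c'_def)
  next
    case False
    then have "sw (c e) = c e" using that by (auto simp: S_def sw_def)
    then show ?thesis by (simp add: c'_def)
  qed
  have "proper_coloring E c'"
    unfolding proper_coloring_def
  proof (intro ballI impI)
    fix e f assume ef: "e \<in> E" "f \<in> E" "e \<noteq> f" "e \<inter> f \<noteq> {}"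
    then obtain u where u: "u \<in> e" "u \<in> f" by auto
    have "c e \<noteq> c f" using proper_coloringD[OF assms(2)] ef u by blast
    then show "c' e \<noteq> c' f"
      using c'K c'nK ef u swinj by (cases "u \<in> K") metis+
  qed
  moreover have "c' ` E \<subseteq> {..<D}"
    using assms(3-5) by (auto simp: c'_def sw_def)
  moreover have "missing D E c' u = missing D E c u" if "u \<notin> K" for u
    using c'nK that by (auto simp: missing_def)
  moreover have "i \<in> missing D E c' u" if "i \<in> missing D E c u" "i \<noteq> \<beta>" "i \<noteq> \<gamma>" for u i
    using that by (auto simp: missing_def c'_def sw_def)
  moreover have "\<beta> \<in> missing D E c' v" if "\<gamma> \<in> missing D E c v"
  proof -
    have "v \<in> K" by (simp add: K_def)
    then show ?thesis using that c'K assms(4) by (auto simp: missing_def sw_def split: if_splits)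
  qed
  ultimately show thesis using that[of c'] c'nK by blast
qed

section \<open>Multi-fans and the adjacency lemma\<close>

text \<open>A Vizing fan in the wide sense: the color of an edge has to be missing at some earlier
  vertex, not necessarily at the preceding one. So a maximal fan is closed under all colors missing
  at its vertices, which the later count relies on. The edge from \<open>x\<close> to the first
  vertex \<open>y\<close> is the uncolored one.\<close>

definition multifan ::
    "nat \<Rightarrow> 'a set set \<Rightarrow> ('a set \<Rightarrow> nat) \<Rightarrow> 'a \<Rightarrow> 'a \<Rightarrow> 'a list \<Rightarrow> bool" where
  "multifan D E c x y zs \<longleftrightarrow> zs \<noteq> [] \<and> zs ! 0 = y \<and> distinct zs \<and>
     (\<forall>i. 0 < i \<longrightarrow> i < length zs \<longrightarrow>
        {x, zs ! i} \<in> E \<and> (\<exists>j<i. c {x, zs ! i} \<in> missing D E c (zs ! j)))"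

lemma multifan_neq:
  assumes "two_uniform E" "multifan D E c x y zs" "x \<noteq> y" "i < length zs"
  shows "zs ! i \<noteq> x"
  using assms two_uniform_neq[OF assms(1), of x "zs ! i"] unfolding multifan_def
  by (cases i) auto

text \<open>Giving \<open>\<beta>\<close> to the edge from \<open>x\<close> to \<open>zs ! m\<close>
  frees its old color at \<open>x\<close>, and that color is missing at an earlier fan vertex, so
  the argument repeats there with a shorter fan. At index 0 the edge is the uncolored one. Coloring,
  fan and free color all change, so the induction generalizes over them.\<close>

lemma multifan_recolor:
  assumes "two_uniform E" "x \<noteq> y" "{x, y} \<notin> E"
    and "proper_coloring E c" "c ` E \<subseteq> {..<D}"
    and "multifan D E c x y zs" "m < length zs"
    and "\<beta> \<in> missing D E c x" "\<beta> \<in> missing D E c (zs ! m)"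
  shows "edge_colorable D (insert {x, y} E)"
  using assms
proof (induction m arbitrary: c zs \<beta> rule: less_induct)
  case (less m)
  have \<beta>: "\<beta> < D" and \<beta>x: "\<And>e. e \<in> E \<Longrightarrow> x \<in> e \<Longrightarrow> c e \<noteq> \<beta>"
    and \<beta>m: "\<And>e. e \<in> E \<Longrightarrow> zs ! m \<in> e \<Longrightarrow> c e \<noteq> \<beta>"
    using less.prems(8,9) by (auto simp: missing_def)
  show ?case
  proof (cases "m = 0")
    case True
    then have zm: "zs ! m = y" using less.prems(6) by (auto simp: multifan_def)
    let ?c = "c({x, y} := \<beta>)"
    have "proper_coloring (insert {x, y} E) ?c"
      by (rule proper_coloring_upd[OF less.prems(4)]) (use \<beta>x \<beta>m zm in auto)
    moreover have "?c ` insert {x, y} E \<subseteq> {..<D}" using \<beta> less.prems(5) by auto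
    ultimately show ?thesis unfolding edge_colorable_def by blast
  next
    case False
    define z where "z = zs ! m"
    from False less.prems(6,7) obtain j where j: "j < m" "c {x, z} \<in> missing D E c (zs ! j)"
      and xz: "{x, z} \<in> E" unfolding multifan_def z_def by auto
    define \<alpha> where "\<alpha> = c {x, z}"
    define c' where "c' = c({x, z} := \<beta>)"
    have neq: "zs ! i \<noteq> z" "zs ! i \<noteq> x" if "i < m" for i
      using that less.prems(6,7) multifan_neq[OF less.prems(1,6,2), of i]
      by (auto simp: multifan_def z_def nth_eq_iff_index_eq)
    have \<beta>z: "c e \<noteq> \<beta>" if "e \<in> E" "z \<in> e" for e using \<beta>m that by (simp add: z_def)
    have pr: "proper_coloring E c'"
      using proper_coloring_upd[OF less.prems(4), of "{x, z}" \<beta>] \<beta>x \<beta>z xz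
      by (auto simp: c'_def insert_absorb)
    have im: "c' ` E \<subseteq> {..<D}" using \<beta> less.prems(5) by (auto simp: c'_def)
    have miss: "missing D E c' (zs ! i) = missing D E c (zs ! i)" if "i < m" for i
      using neq[OF that] by (auto simp: missing_def c'_def)
    have "\<alpha> \<noteq> \<beta>" using \<beta>x[OF xz] by (simp add: \<alpha>_def)
    moreover have "\<alpha> < D" using less.prems(5) xz by (auto simp: \<alpha>_def)
    ultimately have \<alpha>x: "\<alpha> \<in> missing D E c' x"
      using proper_coloringD[OF less.prems(4) _ xz, of _ x]
      by (auto simp: missing_def c'_def \<alpha>_def)
    have \<alpha>j: "\<alpha> \<in> missing D E c' (zs ! j)" using miss[OF j(1)] j(2) by (simp add: \<alpha>_def)
    have fan: "multifan D E c' x y (take (Suc j) zs)"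
    proof -
      have "{x, take (Suc j) zs ! i} \<in> E \<and>
          (\<exists>j'<i. c' {x, take (Suc j) zs ! i} \<in> missing D E c' (take (Suc j) zs ! j'))"
        if i: "0 < i" "i < length (take (Suc j) zs)" for i
      proof -
        from i j(1) less.prems(7) have im: "i < m" "i < length zs" "i < Suc j" by auto
        with less.prems(6) i(1) obtain j' where
          j': "{x, zs ! i} \<in> E" "j' < i" "c {x, zs ! i} \<in> missing D E c (zs ! j')"
          unfolding multifan_def by blast
        have "c' {x, zs ! i} = c {x, zs ! i}"
          using neq[OF im(1)] by (auto simp: c'_def doubleton_eq_iff)
        then show ?thesis using j' im miss[of j'] by auto
      qed
      then show ?thesis using less.prems(6) unfolding multifan_def by auto
    qed
    show ?thesis
      by (rule less.IH[OF j(1) less.prems(1-3) pr im fan _ \<alpha>x])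
        (use \<alpha>j less.prems(7) j(1) in auto)
  qed
qed

text \<open>If two fan vertices missed a common color \<open>\<gamma>\<close>, a Kempe exchange with
  a color \<open>\<beta>\<close> missing at \<open>x\<close> would make one of them miss
  \<open>\<beta>\<close> without touching \<open>x\<close>, and recoloring the fan would color
  \<open>{x, y}\<close>. By induction on the later index, \<open>\<gamma>\<close> is missing at no
  other vertex before it; this keeps the fan intact up to the vertex concerned.\<close>

lemma multifan_missing_disjoint:
  assumes "two_uniform E" "x \<noteq> y" "{x, y} \<notin> E"
    and pc: "proper_coloring E c" "c ` E \<subseteq> {..<D}"
    and nc: "\<not> edge_colorable D (insert {x, y} E)"
    and fan: "multifan D E c x y zs"
    and \<beta>: "\<beta> \<in> missing D E c x"
    and "i < j" "j < length zs"
  shows "missing D E c (zs ! i) \<inter> missing D E c (zs ! j) = {}"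
  using \<open>i < j\<close> \<open>j < length zs\<close>
proof (induction j arbitrary: i rule: less_induct)
  case (less j)
  have xm: "missing D E c x \<inter> missing D E c (zs ! m) = {}" if "m < length zs" for m
    using multifan_recolor[OF assms(1-5) fan that] nc by blast
  show ?case
  proof (rule ccontr)
    assume "\<not> ?thesis"
    then obtain \<gamma> where \<gamma>i: "\<gamma> \<in> missing D E c (zs ! i)" and \<gamma>j: "\<gamma> \<in> missing D E c (zs ! j)"
      by blast
    have lt: "i < length zs" "j < length zs" using less.prems by auto
    have only: "j' = i" if "j' < j" "\<gamma> \<in> missing D E c (zs ! j')" for j'
      using less.IH[of i j'] less.IH[of j' i] less.prems that \<gamma>i
      by (metis disjoint_iff linorder_neqE_nat order_less_trans)
    define S where "S = {e \<in> E. c e \<in> {\<beta>, \<gamma>}}"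
    have \<beta>\<gamma>D: "\<beta> < D" "\<gamma> < D" using \<beta> \<gamma>i by (auto simp: missing_def)
    have \<gamma>x: "\<gamma> \<notin> missing D E c x" using xm[OF lt(1)] \<gamma>i by blast
    have "\<beta> \<noteq> \<gamma>" using \<beta> \<gamma>x by blast
    have S: "two_uniform S" using two_uniform_subset[OF assms(1)] by (auto simp: S_def)
    have injS: "inj_on c {e \<in> S. v \<in> e}" for v
      using proper_coloringD[OF pc(1)] by (auto simp: inj_on_def S_def)
    have deg2: "degree S v \<le> 2" for v
    proof -
      have "degree S v = card (c ` {e \<in> S. v \<in> e})"
        by (simp add: degree_def card_image[OF injS])
      also have "\<dots> \<le> card {\<beta>, \<gamma>}" by (intro card_mono) (auto simp: S_def)
      finally show ?thesis using \<open>\<beta> \<noteq> \<gamma>\<close> by simp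
    qed
    have deg1: "degree S v \<le> 1" if "\<beta> \<in> missing D E c v \<or> \<gamma> \<in> missing D E c v" for v
    proof -
      have "\<exists>\<delta>. c ` {e \<in> S. v \<in> e} \<subseteq> {\<delta>}" using that by (auto simp: S_def missing_def)
      then obtain \<delta> where \<delta>: "c ` {e \<in> S. v \<in> e} \<subseteq> {\<delta>}" by blast
      have "degree S v = card (c ` {e \<in> S. v \<in> e})"
        by (simp add: degree_def card_image[OF injS])
      also have "\<dots> \<le> card {\<delta>}" by (intro card_mono \<delta>) simp
      finally show ?thesis by simp
    qed
    define Kc where "Kc v = {u. (v, u) \<in> (adj_rel S)\<^sup>*}" for v
    \<comment> \<open>The exchange starts at \<open>zs ! m\<close>, and the fan is cut off after
      this vertex. For \<open>m = j\<close> the vertex \<open>zs ! i\<close> has to stay outside the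
      chain as well, because a fan edge colored \<open>\<gamma>\<close> relies on it.\<close>
    have swap: False
      if m: "m = i \<or> m = j" and xK: "x \<notin> Kc (zs ! m)"
        and iK: "m = j \<Longrightarrow> zs ! i \<notin> Kc (zs ! m)" for m
    proof -
      have ml: "m < length zs" "m \<le> j" using m lt less.prems by auto
      have Kdef: "Kc (zs ! m) = {u. (zs ! m, u) \<in> (adj_rel {e \<in> E. c e \<in> {\<beta>, \<gamma>}})\<^sup>*}"
        by (simp add: Kc_def S_def)
      obtain c' where c': "proper_coloring E c'" "c' ` E \<subseteq> {..<D}"
        "\<And>u. u \<notin> Kc (zs ! m) \<Longrightarrow> missing D E c' u = missing D E c u"
        "\<And>u i. i \<in> missing D E c u \<Longrightarrow> i \<noteq> \<beta> \<Longrightarrow> i \<noteq> \<gamma> \<Longrightarrow> i \<in> missing D E c' u"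
        "\<gamma> \<in> missing D E c (zs ! m) \<Longrightarrow> \<beta> \<in> missing D E c' (zs ! m)"
        "\<And>e u. e \<in> E \<Longrightarrow> u \<in> e \<Longrightarrow> u \<notin> Kc (zs ! m) \<Longrightarrow> c' e = c e"
        using kempe_swap[OF assms(1) pc \<beta>\<gamma>D Kdef] by metis
      have fan': "multifan D E c' x y (take (Suc m) zs)"
      proof -
        have "{x, take (Suc m) zs ! l} \<in> E \<and>
            (\<exists>j'<l. c' {x, take (Suc m) zs ! l} \<in> missing D E c' (take (Suc m) zs ! j'))"
          if l: "0 < l" "l < length (take (Suc m) zs)" for l
        proof -
          from l have lm: "l \<le> m" "l < length zs" by auto
          with fan l(1) obtain j' where
            j': "{x, zs ! l} \<in> E" "j' < l" "c {x, zs ! l} \<in> missing D E c (zs ! j')"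
            unfolding multifan_def by blast
          have eq: "c' {x, zs ! l} = c {x, zs ! l}" using c'(6)[OF j'(1) _ xK] by simp
          have nb: "c {x, zs ! l} \<noteq> \<beta>" using \<beta> j'(1) by (auto simp: missing_def)
          have "c {x, zs ! l} \<in> missing D E c' (zs ! j')"
          proof (cases "c {x, zs ! l} = \<gamma>")
            case True
            then have "j' = i" using only[of j'] j' lm ml by auto
            with j'(2) lm m have "m = j" by auto
            then show ?thesis using c'(3)[OF iK] j'(3) \<open>j' = i\<close> by simp
          next
            case False
            then show ?thesis using c'(4)[OF j'(3) nb] by simp
          qed
          then show ?thesis using j' eq lm by auto
        qed
        then show ?thesis using fan unfolding multifan_def by auto
      qed
      have "\<beta> \<in> missing D E c' x" using c'(3)[OF xK] \<beta> by simp
      moreover have "\<beta> \<in> missing D E c' (take (Suc m) zs ! m)"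
        using c'(5) m \<gamma>i \<gamma>j by auto
      ultimately show False
        using multifan_recolor[OF assms(1-3) c'(1,2) fan', of m \<beta>] nc ml by simp
    qed
    have ne: "x \<noteq> zs ! i" "x \<noteq> zs ! j" "zs ! i \<noteq> zs ! j"
      using multifan_neq[OF assms(1) fan assms(2) lt(1)] multifan_neq[OF assms(1) fan assms(2) lt(2)]
        lt fan less.prems(1) by (auto simp: multifan_def nth_eq_iff_index_eq)
    have symK: "a \<in> Kc b \<longleftrightarrow> b \<in> Kc a" for a b
      using adj_rel_sym[of a b S] adj_rel_sym[of b a S] by (auto simp: Kc_def)
    show False
    proof (cases "zs ! i \<in> Kc x")
      case False
      then show False using swap[of i] symK less.prems by auto
    next
      case True
      \<comment> \<open>All three vertices have degree at most 1 in the two colors, so a chain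
        containing \<open>x\<close> and \<open>zs ! i\<close> has both its ends there.\<close>
      have "zs ! j \<notin> Kc x"
        using path_has_two_ends[OF S deg2 deg1 deg1 deg1 ne] \<beta> \<gamma>i \<gamma>j True
        by (auto simp: Kc_def)
      moreover from this True have "zs ! i \<notin> Kc (zs ! j)"
        unfolding Kc_def by (auto dest: rtrancl_trans adj_rel_sym)
      ultimately show False using swap[of j] symK by blast
    qed
  qed
qed

lemma degree_insert_edge:
  assumes "two_uniform E" "x \<noteq> y" "{x, y} \<notin> E"
  shows "degree (insert {x, y} E) v = degree E v + (if v \<in> {x, y} then 1 else 0)"
proof -
  have "{e \<in> insert {x, y} E. v \<in> e} =
      (if v \<in> {x, y} then insert {x, y} {e \<in> E. v \<in> e} else {e \<in> E. v \<in> e})" by auto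
  then show ?thesis using assms unfolding degree_def two_uniform_def by auto
qed

text \<open>In a maximal multifan every color missing at a fan vertex occurs at \<open>x\<close> on
  an edge to a fan vertex other than \<open>y\<close>. The missing sets are disjoint, so together
  they have at most as many colors as there are such vertices. Each of these that is not full misses
  at least one color, so the \<open>D - degree E y + 1\<close> colors missing at \<open>y\<close>
  must be made up for by full neighbors of \<open>x\<close>, of which there are too few.\<close>

lemma vizing_adjacency:
  assumes E: "two_uniform E" and xy: "{x, y} \<in> E"
    and deg: "\<And>v. degree E v \<le> D"
    and col: "edge_colorable D (E - {{x, y}})"
    and full: "card {z \<in> nbrs E x. z \<noteq> y \<and> degree E z = D} + degree E y \<le> D"
  shows "edge_colorable D E"
proof (rule ccontr)
  define E' where "E' = E - {{x, y}}"
  assume "\<not> edge_colorable D E"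
  have EE': "E = insert {x, y} E'" using xy by (auto simp: E'_def)
  have nc: "\<not> edge_colorable D (insert {x, y} E')"
    using \<open>\<not> edge_colorable D E\<close> EE' by simp
  have E': "two_uniform E'" using two_uniform_subset[OF E] by (simp add: E'_def)
  have "x \<noteq> y" using two_uniform_neq[OF E xy] .
  have nin: "{x, y} \<notin> E'" by (simp add: E'_def)
  obtain c where c: "proper_coloring E' c" "c ` E' \<subseteq> {..<D}"
    using col unfolding edge_colorable_def E'_def by blast
  have degE: "degree E v = degree E' v + (if v \<in> {x, y} then 1 else 0)" for v
    using degree_insert_edge[OF E' \<open>x \<noteq> y\<close> nin] EE' by simp
  have cm: "card (missing D E' c v) + degree E' v = D" for v
    using card_missing[OF E' c] .
  have "card (missing D E' c x) > 0" using cm[of x] deg[of x] degE[of x] by simp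
  then obtain \<beta> where \<beta>: "\<beta> \<in> missing D E' c x" by (metis card_gt_0_iff ex_in_conv)
  have lenb: "length zs \<le> card (nbrs E x)" if "multifan D E' c x y zs" for zs
  proof -
    have "set zs \<subseteq> nbrs E x"
    proof
      fix z assume "z \<in> set zs"
      then obtain i where "i < length zs" "z = zs ! i" by (auto simp: in_set_conv_nth)
      then show "z \<in> nbrs E x" using that xy unfolding multifan_def
        by (cases i) (auto simp: E'_def)
    qed
    then have "card (set zs) \<le> card (nbrs E x)" by (intro card_mono finite_nbrs[OF E])
    moreover have "distinct zs" using that by (simp add: multifan_def)
    ultimately show ?thesis by (simp add: distinct_card)
  qed
  have "multifan D E' c x y [y]" by (simp add: multifan_def)
  then obtain zs where fan: "multifan D E' c x y zs"
    and maxl: "\<And>zs'. multifan D E' c x y zs' \<Longrightarrow> length zs' \<le> length zs"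
    using ex_has_greatest_nat[of "multifan D E' c x y" "[y]" length "Suc (card (nbrs E x))"] lenb
    by (metis le_imp_less_Suc)
  have dist: "distinct zs" and zne: "zs \<noteq> []" and z0: "zs ! 0 = y"
    using fan by (auto simp: multifan_def)
  have ysub: "y \<in> set zs" using zne z0 by (metis length_greater_0_conv nth_mem)
  define F where "F = set zs - {y}"
  have image: "(\<Union>z\<in>set zs. missing D E' c z) \<subseteq> (\<lambda>u. c {x, u}) ` F"
  proof
    fix \<gamma> assume "\<gamma> \<in> (\<Union>z\<in>set zs. missing D E' c z)"
    then obtain m where m: "m < length zs" "\<gamma> \<in> missing D E' c (zs ! m)"
      by (auto simp: in_set_conv_nth)
    have "\<gamma> \<notin> missing D E' c x"
      using multifan_recolor[OF E' \<open>x \<noteq> y\<close> nin c fan m(1) _ m(2)] nc by blast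
    then obtain e where e: "e \<in> E'" "x \<in> e" "c e = \<gamma>"
      using m(2) by (auto simp: missing_def)
    then obtain u where u: "e = {x, u}" "u \<noteq> x" using two_uniform_edgeE[OF E'] by metis
    \<comment> \<open>Otherwise \<open>u\<close> could be appended to the maximal fan, as the color
      of \<open>{x, u}\<close> is missing at \<open>zs ! m\<close>.\<close>
    have "u \<in> set zs"
    proof (rule ccontr)
      assume "u \<notin> set zs"
      have "multifan D E' c x y (zs @ [u])"
        unfolding multifan_def
      proof (intro conjI allI impI)
        show "zs @ [u] \<noteq> []" by simp
        show "(zs @ [u]) ! 0 = y" using zne z0 by (simp add: nth_append)
        show "distinct (zs @ [u])" using dist \<open>u \<notin> set zs\<close> by simp
        fix i assume i: "0 < i" "i < length (zs @ [u])"
        show "{x, (zs @ [u]) ! i} \<in> E'"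
          using i fan e u by (cases "i < length zs") (auto simp: multifan_def nth_append less_Suc_eq)
        show "\<exists>j<i. c {x, (zs @ [u]) ! i} \<in> missing D E' c ((zs @ [u]) ! j)"
        proof (cases "i < length zs")
          case True
          with fan i(1) obtain j where
            "j < i" "c {x, zs ! i} \<in> missing D E' c (zs ! j)"
            unfolding multifan_def by blast
          with True show ?thesis by (auto simp: nth_append intro!: exI[of _ j])
        next
          case False
          then have "i = length zs" using i by simp
          then show ?thesis using m e u by (auto simp: nth_append intro!: exI[of _ m])
        qed
      qed
      then show False using maxl by fastforce
    qed
    moreover have "u \<noteq> y" using e u nin by auto
    ultimately show "\<gamma> \<in> (\<lambda>u. c {x, u}) ` F" using e u by (auto simp: F_def)
  qed
  have "(\<Sum>z\<in>set zs. card (missing D E' c z)) = card (\<Union>z\<in>set zs. missing D E' c z)"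
  proof (rule card_UN_disjoint[symmetric])
    show "\<forall>i\<in>set zs. \<forall>j\<in>set zs. i \<noteq> j \<longrightarrow> missing D E' c i \<inter> missing D E' c j = {}"
    proof (intro ballI impI)
      fix a b assume "a \<in> set zs" "b \<in> set zs" "a \<noteq> b"
      then obtain i j where ij: "i < length zs" "j < length zs" "a = zs ! i" "b = zs ! j" "i \<noteq> j"
        by (metis in_set_conv_nth)
      note d = multifan_missing_disjoint[OF E' \<open>x \<noteq> y\<close> nin c nc fan \<beta>]
      show "missing D E' c a \<inter> missing D E' c b = {}"
        using d[of i j] d[of j i] ij by (metis inf_commute linorder_neqE_nat)
    qed
  qed auto
  also have "\<dots> \<le> card ((\<lambda>u. c {x, u}) ` F)" by (intro card_mono image) (simp add: F_def)
  also have "\<dots> \<le> card F" by (intro card_image_le) (simp add: F_def)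
  finally have le: "(\<Sum>z\<in>set zs. card (missing D E' c z)) \<le> card F" .
  define A where "A = {z \<in> F. degree E z = D}"
  have xF: "x \<notin> F"
    using multifan_neq[OF E' fan \<open>x \<noteq> y\<close>] by (auto simp: F_def in_set_conv_nth)
  have "card (missing D E' c y) + card (F - A) \<le> (\<Sum>z\<in>set zs. card (missing D E' c z))"
  proof -
    have "card (F - A) = (\<Sum>z\<in>F - A. 1)" by simp
    also have "\<dots> \<le> (\<Sum>z\<in>F - A. card (missing D E' c z))"
    proof (rule sum_mono)
      fix z assume z: "z \<in> F - A"
      then have "degree E z < D" using deg[of z] by (auto simp: A_def)
      then show "1 \<le> card (missing D E' c z)" using cm[of z] degE[of z] by simp
    qed
    also have "\<dots> \<le> (\<Sum>z\<in>F. card (missing D E' c z))"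
      by (intro sum_mono2) (auto simp: F_def)
    finally show ?thesis
      using ysub by (simp add: F_def sum.remove)
  qed
  moreover have "card F = card A + card (F - A)"
    using card_Un_disjoint[of A "F - A"] by (simp add: A_def F_def Un_Diff_cancel2 sup.absorb2 subset_iff)
  moreover have "card A \<le> card {z \<in> nbrs E x. z \<noteq> y \<and> degree E z = D}"
  proof (rule card_mono)
    show "finite {z \<in> nbrs E x. z \<noteq> y \<and> degree E z = D}"
      by (rule finite_subset[OF _ finite_nbrs[OF E, of x]]) auto
    have "{x, z} \<in> E" if "z \<in> F" for z
    proof -
      from that obtain i where i: "i < length zs" "z = zs ! i" "z \<noteq> y"
        by (auto simp: F_def in_set_conv_nth)
      then have "0 < i" using z0 by (cases i) auto
      then show ?thesis using fan i by (auto simp: multifan_def E'_def)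
    qed
    then show "A \<subseteq> {z \<in> nbrs E x. z \<noteq> y \<and> degree E z = D}" by (auto simp: A_def F_def)
  qed
  ultimately show False using le full cm[of y] degE[of y] by simp
qed

section \<open>Extending edge colorings\<close>

lemma colorable_add_matching:
  assumes "edge_colorable k E" "pairwise disjnt F"
  shows "edge_colorable (Suc k) (E \<union> F)"
proof -
  obtain c where c: "proper_coloring E c" "c ` E \<subseteq> {..<k}"
    using assms(1) unfolding edge_colorable_def by blast
  define c' where "c' e = (if e \<in> E then c e else k)" for e
  have "proper_coloring (E \<union> F) c'"
    unfolding proper_coloring_def
  proof (intro ballI impI)
    fix e f assume ef: "e \<in> E \<union> F" "f \<in> E \<union> F" "e \<noteq> f" "e \<inter> f \<noteq> {}"
    have lt: "c e < k" if "e \<in> E" for e using c(2) that by auto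
    have "e \<in> E \<or> f \<in> E"
      using ef assms(2) by (auto simp: pairwise_def disjnt_def)
    then show "c' e \<noteq> c' f"
      using ef c(1) lt[of e] lt[of f] by (auto simp: c'_def proper_coloring_def)
  qed
  moreover have "c' ` (E \<union> F) \<subseteq> {..<Suc k}" using c(2) by (auto simp: c'_def)
  ultimately show ?thesis unfolding edge_colorable_def by blast
qed

lemma colorable_add_matchings:
  assumes "edge_colorable k E" "finite I" "\<And>i. i \<in> I \<Longrightarrow> pairwise disjnt (F i)"
  shows "edge_colorable (k + card I) (E \<union> (\<Union>i\<in>I. F i))"
  using assms(2,3)
proof (induction I)
  case (insert i I)
  then have "edge_colorable (Suc (k + card I)) ((E \<union> (\<Union>i\<in>I. F i)) \<union> F i)"
    by (intro colorable_add_matching) auto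
  with insert show ?case by (simp add: Un_ac)
qed (use assms(1) in simp)

text \<open>The edges at \<open>a\<close> are inserted one by one, with the adjacency lemma used in
  both directions. Edges to neighbors of degree above \<open>D - s\<close> come first, centered at
  the neighbor: as long as only these are present, the degree of \<open>a\<close> is small, so that
  even all full vertices may be counted. The other edges are centered at \<open>a\<close>, which has
  at most \<open>s\<close> full neighbors.\<close>

lemma colorable_add_vertex:
  assumes E: "two_uniform E" and deg: "\<And>v. degree E v \<le> D"
    and col: "edge_colorable D {e \<in> E. a \<notin> e}"
    and full: "card {z \<in> nbrs E a. degree E z = D} \<le> s"
    and poor: "card {y \<in> nbrs E a. D < degree E y + s} + card {v \<in> \<Union>E. degree E v = D} \<le> D"
  shows "edge_colorable D E"
proof -
  define G where "G Z = {e \<in> E. a \<notin> e} \<union> (\<lambda>z. {a, z}) ` Z" for Z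
  define L where "L = {y \<in> nbrs E a. D < degree E y + s}"
  have finN: "finite (nbrs E a)" by (rule finite_nbrs[OF E])
  have ane: "z \<noteq> a" if "z \<in> nbrs E a" for z
    using that two_uniform_neq[OF E, of a z] by auto
  have finUE: "finite (\<Union>E)"
    using E unfolding two_uniform_def by (metis card.infinite finite_Union zero_neq_numeral)
  have sub: "G Z \<subseteq> E" if "Z \<subseteq> nbrs E a" for Z using that by (auto simp: G_def)
  have nbG: "nbrs (G Z) a = Z" if "Z \<subseteq> nbrs E a" for Z
    using that ane by (auto simp: G_def doubleton_eq_iff)
  have minus: "G (insert z Z) - {{a, z}} = G Z" if "z \<notin> Z" for z Z
    using that by (auto simp: G_def doubleton_eq_iff)
  have degle: "degree (G Z) v \<le> degree E v" if "Z \<subseteq> nbrs E a" for Z v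
    using degree_mono[OF E sub[OF that]] .
  have eqD: "degree E v = D" if "degree (G Z) v = D" "Z \<subseteq> nbrs E a" for Z v
    using degle[OF that(2), of v] that(1) deg[of v] by simp
  have low: "edge_colorable D (G Z)" if "Z \<subseteq> L" for Z
  proof -
    have "finite Z" by (rule finite_subset[OF _ finN]) (use that in \<open>auto simp: L_def\<close>)
    then show ?thesis using that
    proof (induction Z)
      case empty
      then show ?case using col by (simp add: G_def)
    next
      case (insert z Z)
      have "L \<subseteq> nbrs E a" by (auto simp: L_def)
      then have Z: "insert z Z \<subseteq> nbrs E a" "finite L"
        using insert.prems finite_subset[OF _ finN] by blast+
      define H where "H = G (insert z Z)"
      have H: "two_uniform H" using two_uniform_subset[OF E sub[OF Z(1)]] by (simp add: H_def)
      have "card {u \<in> nbrs H z. u \<noteq> a \<and> degree H u = D} \<le> card {v \<in> \<Union>E. degree E v = D}"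
        using eqD[OF _ Z(1)] sub[OF Z(1)] unfolding H_def
        by (intro card_mono finite_subset[OF _ finUE, of "{v \<in> \<Union>E. P v}" for P]) auto
      moreover have "degree H a \<le> card L"
        unfolding degree_eq_card_nbrs[OF H] unfolding H_def nbG[OF Z(1)]
        using Z(2) insert.prems by (intro card_mono) auto
      ultimately have "card {u \<in> nbrs H z. u \<noteq> a \<and> degree H u = D} + degree H a \<le> D"
        using poor by (simp add: L_def)
      moreover have "{z, a} \<in> H" by (simp add: H_def G_def insert_commute)
      moreover have "edge_colorable D (H - {{z, a}})"
        using insert minus[OF insert(2)] by (simp add: H_def insert_commute)
      moreover have "degree H v \<le> D" for v
        using degle[OF Z(1), of v] deg[of v] by (simp add: H_def)
      ultimately have "edge_colorable D H"
        using vizing_adjacency[OF H] by blast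
      then show ?case by (simp add: H_def)
    qed
  qed
  have "edge_colorable D (G (L \<union> Z))" if "Z \<subseteq> nbrs E a - L" for Z
  proof -
    have "finite Z" by (rule finite_subset[OF _ finN]) (use that in auto)
    then show ?thesis using that
    proof (induction Z)
      case empty
      then show ?case using low by simp
    next
      case (insert z Z)
      define H where "H = G (insert z (L \<union> Z))"
      have Z: "insert z (L \<union> Z) \<subseteq> nbrs E a" using insert.prems by (auto simp: L_def)
      have H: "two_uniform H" using two_uniform_subset[OF E sub[OF Z]] by (simp add: H_def)
      have "card {u \<in> nbrs H a. u \<noteq> z \<and> degree H u = D} \<le> s"
      proof (rule order_trans[OF card_mono full])
        show "finite {z \<in> nbrs E a. degree E z = D}"
          by (rule finite_subset[OF _ finN]) auto
        show "{u \<in> nbrs H a. u \<noteq> z \<and> degree H u = D} \<subseteq> {z \<in> nbrs E a. degree E z = D}"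
          using eqD[OF _ Z] sub[OF Z] by (auto simp: H_def)
      qed
      moreover have "degree H z + s \<le> D"
        using degle[OF Z, of z] insert.prems by (auto simp: L_def H_def)
      ultimately have "card {u \<in> nbrs H a. u \<noteq> z \<and> degree H u = D} + degree H z \<le> D"
        by linarith
      moreover have "{a, z} \<in> H" by (simp add: H_def G_def)
      moreover have "edge_colorable D (H - {{a, z}})"
        using insert minus[of z "L \<union> Z"] by (auto simp: H_def)
      moreover have "degree H v \<le> D" for v
        using degle[OF Z, of v] deg[of v] by (simp add: H_def)
      ultimately have "edge_colorable D H"
        using vizing_adjacency[OF H] by blast
      then show ?case by (simp add: H_def)
    qed
  qed
  from this[of "nbrs E a - L"] have "edge_colorable D (G (nbrs E a))"
    by (simp add: L_def Un_absorb1 subset_iff Un_Diff_cancel)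
  moreover have "E \<subseteq> G (nbrs E a)"
  proof
    fix e assume e: "e \<in> E"
    show "e \<in> G (nbrs E a)"
    proof (cases "a \<in> e")
      case True
      from E e this obtain z where "e = {a, z}" by (rule two_uniform_edgeE)
      then show ?thesis using e by (simp add: G_def)
    qed (use e in \<open>simp add: G_def\<close>)
  qed
  ultimately show ?thesis by (rule edge_colorable_subset)
qed

text \<open>Deleting vertices raises no degree and creates no new vertex of degree \<open>D\<close>,
  so the bounds, stated once for the whole of \<open>E\<close>, hold at every stage, in whatever
  order \<open>B\<close> is put back.\<close>

lemma colorable_add_vertices:
  assumes "finite B" "two_uniform E" "\<And>v. degree E v \<le> D"
    and "\<And>a. a \<in> B \<Longrightarrow> card {z \<in> nbrs E a. degree E z = D} \<le> s"
    and "\<And>a. a \<in> B \<Longrightarrow>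
      card {y \<in> nbrs E a. D < degree E y + s} + card {v \<in> \<Union>E. degree E v = D} \<le> D"
    and "edge_colorable D {e \<in> E. e \<inter> B = {}}"
  shows "edge_colorable D E"
  using assms(1,4-6)
proof (induction B)
  case empty
  then show ?case by simp
next
  case (insert a B)
  define F where "F = {e \<in> E. e \<inter> B = {}}"
  have sub: "F \<subseteq> E" by (auto simp: F_def)
  have F: "two_uniform F" by (rule two_uniform_subset[OF assms(2) sub])
  have degle: "degree F v \<le> degree E v" for v by (rule degree_mono[OF assms(2) sub])
  have eqD: "degree E v = D" if "degree F v = D" for v
    using degle[of v] that assms(3)[of v] by simp
  have fin: "finite (nbrs E a)" "finite (\<Union>E)"
    using finite_nbrs[OF assms(2)] assms(2) unfolding two_uniform_def
    by (auto intro!: finite_Union) (metis card.infinite zero_neq_numeral)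
  have finF: "finite {z \<in> nbrs E a. P z}" for P
    by (rule finite_subset[OF _ fin(1)]) auto
  have "edge_colorable D F"
  proof (rule colorable_add_vertex[OF F])
    show "degree F v \<le> D" for v using degle[of v] assms(3)[of v] by simp
    have "{e \<in> F. a \<notin> e} = {e \<in> E. e \<inter> insert a B = {}}" by (auto simp: F_def)
    then show "edge_colorable D {e \<in> F. a \<notin> e}" using insert.prems(3) by simp
    show "card {z \<in> nbrs F a. degree F z = D} \<le> s"
      by (rule order_trans[OF card_mono[OF finF] insert.prems(1)[of a]]) (use sub eqD in auto)
    have "card {y \<in> nbrs F a. D < degree F y + s} \<le> card {y \<in> nbrs E a. D < degree E y + s}"
      using sub degle by (intro card_mono finF) (auto intro: less_le_trans)
    moreover have "card {v \<in> \<Union>F. degree F v = D} \<le> card {v \<in> \<Union>E. degree E v = D}"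
      using sub eqD by (intro card_mono finite_subset[OF _ fin(2), of "{v \<in> \<Union>E. P v}" for P]) auto
    ultimately show "card {y \<in> nbrs F a. D < degree F y + s} + card {v \<in> \<Union>F. degree F v = D} \<le> D"
      using insert.prems(2)[of a] by simp
  qed
  then show ?case using insert by (simp add: F_def)
qed

text \<open>This is Vizing's theorem for maximum degree below \<open>D\<close>: without full
  vertices the adjacency lemma asks only for \<open>degree E y \<le> D\<close>.\<close>

lemma colorable_no_full_vertex:
  assumes "two_uniform E" "\<And>v. degree E v < D"
  shows "edge_colorable D E"
proof -
  have "finite E" using assms(1) by (simp add: two_uniform_def)
  then show ?thesis using assms
  proof (induction E)
    case empty
    then show ?case by (simp add: edge_colorable_def proper_coloring_def)
  next
    case (insert e E)
    have sub: "E \<subseteq> insert e E" by auto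
    have "degree E v < D" for v
      using degree_mono[OF insert.prems(1) sub, of v] insert.prems(2)[of v] by simp
    then have IH: "edge_colorable D E"
      using insert.IH two_uniform_subset[OF insert.prems(1) sub] by blast
    have "card e = 2" using insert.prems(1) by (simp add: two_uniform_def)
    then obtain x y where "e = {x, y}" by (auto simp: card_2_iff)
    then show ?case
      using vizing_adjacency[OF insert.prems(1), of x y D] IH insert.prems(2) insert.hyps(2)
      by (auto simp: less_imp_le less_imp_neq)
  qed
qed

lemma card_Union_two_uniform:
  assumes "finite M" "pairwise disjnt M" "\<And>e. e \<in> M \<Longrightarrow> card e = 2"
  shows "card (\<Union>M) = 2 * card M"
proof -
  have "card (\<Union>M) = (\<Sum>e\<in>M. card e)"
  proof (rule card_Union_disjoint[OF assms(2)])
    fix e assume "e \<in> M"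
    then show "finite e" using assms(3) by (metis card.infinite zero_neq_numeral)
  qed
  then show ?thesis using assms(3) by simp
qed

text \<open>By parity each color class of \<open>E - w\<close> misses some vertex, and only the neighbours of \<open>w\<close>
  miss a color, one each; so the missing colors are all different.\<close>

lemma regular_colorable_add_vertex:
  assumes "finite V" "even (card V)" "w \<in> V"
    and E: "two_uniform E" and EV: "\<Union>E \<subseteq> V" and reg: "\<And>v. v \<in> V \<Longrightarrow> degree E v = k"
    and col: "edge_colorable k {e \<in> E. w \<notin> e}"
  shows "edge_colorable k E"
proof -
  define E' where "E' = {e \<in> E. w \<notin> e}"
  have E': "two_uniform E'" using two_uniform_subset[OF E] by (auto simp: E'_def)
  obtain c where c: "proper_coloring E' c" "c ` E' \<subseteq> {..<k}"
    using col unfolding edge_colorable_def E'_def by blast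
  have degE': "degree E v = degree E' v + (if {w, v} \<in> E then 1 else 0)" if "v \<noteq> w" for v
  proof -
    have eq: "e = {w, v}" if "e \<in> E" "w \<in> e" "v \<in> e" for e
      using two_uniform_edgeE[OF E that(1,2)] that(3) \<open>v \<noteq> w\<close> by auto
    have "{e \<in> E. v \<in> e} = {e \<in> E'. v \<in> e} \<union> (if {w, v} \<in> E then {{w, v}} else {})"
    proof (intro set_eqI iffI)
      fix e assume "e \<in> {e \<in> E. v \<in> e}"
      then show "e \<in> {e \<in> E'. v \<in> e} \<union> (if {w, v} \<in> E then {{w, v}} else {})"
        using eq[of e] by (cases "w \<in> e") (auto simp: E'_def)
    qed (auto simp: E'_def split: if_splits)
    moreover have "finite {e \<in> E'. v \<in> e}" using E' by (simp add: two_uniform_def)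
    moreover have "{w, v} \<notin> E'" by (simp add: E'_def)
    ultimately show ?thesis unfolding degree_def by (cases "{w, v} \<in> E") auto
  qed
  have cm: "card (missing k E' c v) = (if {w, v} \<in> E then 1 else 0)" if "v \<in> V - {w}" for v
    using card_missing[OF E' c, of v] degE'[of v] reg[of v] that by auto
  \<comment> \<open>A color present at every vertex other than \<open>w\<close> would be a perfect
    matching on an odd number of vertices.\<close>
  have "\<exists>v\<in>V - {w}. i \<in> missing k E' c v" if "i < k" for i
  proof (rule ccontr)
    assume none: "\<not> ?thesis"
    let ?M = "{e \<in> E'. c e = i}"
    have U: "\<Union>?M = V - {w}"
    proof
      show "\<Union>?M \<subseteq> V - {w}" using EV by (auto simp: E'_def)
      show "V - {w} \<subseteq> \<Union>?M" using none that by (fastforce simp: missing_def)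
    qed
    have "pairwise disjnt ?M"
      using c(1) by (auto simp: pairwise_def disjnt_def proper_coloring_def)
    then have "card (\<Union>?M) = 2 * card ?M"
      using E' by (intro card_Union_two_uniform) (auto simp: two_uniform_def)
    then have "even (card (V - {w}))" unfolding U by simp
    moreover have "card V = Suc (card (V - {w}))" using assms(1,3) by (rule card.remove)
    ultimately show False using assms(2) by simp
  qed
  then obtain g where g: "\<And>i. i < k \<Longrightarrow> g i \<in> V - {w} \<and> i \<in> missing k E' c (g i)"
    by metis
  have one: "card (missing k E' c (g i)) = 1" "{w, g i} \<in> E" if "i < k" for i
    using cm[of "g i"] g[OF that] by (auto split: if_splits)
  have injg: "inj_on g {..<k}"
  proof (rule inj_onI)
    fix i j assume ij: "i \<in> {..<k}" "j \<in> {..<k}" "g i = g j"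
    then have "{i, j} \<subseteq> missing k E' c (g i)" using g[of i] g[of j] by auto
    then have "card {i, j} \<le> card (missing k E' c (g i))" by (intro card_mono) simp_all
    then have "card {i, j} \<le> 1" using one(1)[of i] ij by simp
    then show "i = j" by (cases "i = j") auto
  qed
  \<comment> \<open>There are \<open>k\<close> colors and \<open>k\<close> neighbors of
    \<open>w\<close>, so the injection is onto. Its inverse \<open>m\<close> assigns to each edge at
    \<open>w\<close> the color missing at the other end.\<close>
  have img: "g ` {..<k} = nbrs E w"
    by (rule card_subset_eq)
      (use one(2) finite_nbrs[OF E] card_image[OF injg] reg[OF assms(3)] degree_eq_card_nbrs[OF E]
        in auto)
  define m where "m = inv_into {..<k} g"
  have m: "m y < k" "m y \<in> missing k E' c y" if "{w, y} \<in> E" for y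
  proof -
    have y: "y \<in> g ` {..<k}" using img that by simp
    show "m y < k" using inv_into_into[OF y] by (simp add: m_def)
    show "m y \<in> missing k E' c y"
      using g[of "m y"] f_inv_into_f[OF y] \<open>m y < k\<close> by (simp add: m_def)
  qed
  have minj: "y = y'" if "{w, y} \<in> E" "{w, y'} \<in> E" "m y = m y'" for y y'
    using that img unfolding m_def by (metis in_nbrs inv_into_injective)
  define h where "h e = (if w \<in> e then m (SOME y. y \<in> e \<and> y \<noteq> w) else c e)" for e
  have hw: "h {w, y} = m y" if "{w, y} \<in> E" for y
  proof -
    have "(SOME z. z \<in> {w, y} \<and> z \<noteq> w) = y"
      using two_uniform_neq[OF E that] by (intro some_equality) auto
    then show ?thesis by (simp add: h_def)
  qed
  have mixed: "h e \<noteq> h f" if "e \<in> E" "f \<in> E" "w \<in> e" "w \<notin> f" "e \<inter> f \<noteq> {}" for e f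
  proof -
    from E that(1,3) obtain y where y: "e = {w, y}" by (rule two_uniform_edgeE)
    then have "y \<in> f" "f \<in> E'" using that by (auto simp: E'_def)
    then have "c f \<noteq> m y" using m(2)[of y] y that(1) by (auto simp: missing_def)
    then show ?thesis using hw[of y] y that by (simp add: h_def)
  qed
  have "proper_coloring E h"
    unfolding proper_coloring_def
  proof (intro ballI impI)
    fix e f assume ef: "e \<in> E" "f \<in> E" "e \<noteq> f" "e \<inter> f \<noteq> {}"
    consider "w \<in> e" "w \<in> f" | "w \<in> e" "w \<notin> f" | "w \<notin> e" "w \<in> f" | "w \<notin> e" "w \<notin> f" by blast
    then show "h e \<noteq> h f"
    proof cases
      case 1
      then obtain y y' where "e = {w, y}" "f = {w, y'}"
        using two_uniform_edgeE[OF E] ef by metis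
      then show ?thesis using hw minj ef by metis
    next
      case 2
      then show ?thesis using mixed[of e f] ef by simp
    next
      case 3
      then show ?thesis using mixed[of f e] ef by (metis inf_commute)
    next
      case 4
      then show ?thesis using c(1) ef by (auto simp: proper_coloring_def h_def E'_def)
    qed
  qed
  moreover have "h e < k" if "e \<in> E" for e
  proof (cases "w \<in> e")
    case True
    from E that this obtain y where "e = {w, y}" by (rule two_uniform_edgeE)
    then show ?thesis using hw m(1) that by auto
  next
    case False
    then show ?thesis using c(2) that by (auto simp: h_def E'_def)
  qed
  then have "h ` E \<subseteq> {..<k}" by auto
  ultimately show ?thesis unfolding edge_colorable_def by blast
qed

section \<open>Perfect matchings containing prescribed edges\<close>

text \<open>If a largest matching is not perfect, parity leaves two uncovered vertices
  \<open>u\<close> and \<open>v\<close>. Their neighbors are all covered, and the mate of a neighbor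
  of \<open>u\<close> is never a neighbor of \<open>v\<close>, for otherwise a path of three edges
  would augment the matching. So the two degrees add up to at most the number of covered vertices,
  against the degree condition.\<close>

lemma dirac_perfect_matching:
  assumes R: "finite R" "even (card R)"
    and deg: "\<And>v. v \<in> R \<Longrightarrow> card R \<le> 2 * card {u \<in> R. u \<noteq> v \<and> {v, u} \<in> E}"
  shows "\<exists>M\<subseteq>E. pairwise disjnt M \<and> \<Union>M = R \<and> (\<forall>e\<in>M. card e = 2)"
proof -
  define P where "P M \<longleftrightarrow> M \<subseteq> E \<and> pairwise disjnt M \<and> \<Union>M \<subseteq> R \<and> (\<forall>e\<in>M. card e = 2)" for M
  have fin: "finite M" if "P M" for M
    using that R(1) by (auto simp: P_def intro: finite_subset[of M "Pow R"])
  have cU: "card (\<Union>M) = 2 * card M" if "P M" for M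
    using card_Union_two_uniform[OF fin[OF that]] that by (auto simp: P_def)
  have "card M < Suc (card R)" if "P M" for M
  proof -
    have "card (\<Union>M) \<le> card R" using that R(1) by (intro card_mono) (auto simp: P_def)
    then show ?thesis using cU[OF that] by simp
  qed
  moreover have "P {}" by (simp add: P_def)
  ultimately obtain M where M: "P M" and maxM: "\<And>M'. P M' \<Longrightarrow> card M' \<le> card M"
    using ex_has_greatest_nat[of P "{}" card] by metis
  have "\<Union>M = R"
  proof (rule ccontr)
    assume ne: "\<Union>M \<noteq> R"
    have sub: "\<Union>M \<subseteq> R" using M by (simp add: P_def)
    have finU: "finite (\<Union>M)" using sub R(1) by (rule finite_subset)
    have "card (R - \<Union>M) = card R - 2 * card M"
      using cU[OF M] card_Diff_subset[OF finU sub] by simp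
    then have "even (card (R - \<Union>M))" using R(2) by simp
    moreover have "card (R - \<Union>M) \<noteq> 0" using ne sub R(1) by auto
    ultimately have ge2: "2 \<le> card (R - \<Union>M)" by presburger
    then obtain u v where uv: "u \<in> R - \<Union>M" "v \<in> R - \<Union>M" "u \<noteq> v"
      by (metis card_le_Suc0_iff_eq card.infinite not_less_eq_eq numeral_2_eq_2 zero_le le_zero_eq nat.distinct(1))
    define nb where "nb x = {y \<in> R. y \<noteq> x \<and> {x, y} \<in> E}" for x
    have disjM: "e = f" if "e \<in> M" "f \<in> M" "x \<in> e" "x \<in> f" for e f x
      using M that unfolding P_def pairwise_def disjnt_def by blast
    have "nb x \<subseteq> \<Union>M" if x: "x \<in> R - \<Union>M" for x
    proof
      fix y assume y: "y \<in> nb x"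
      show "y \<in> \<Union>M"
      proof (rule ccontr)
        assume yM: "y \<notin> \<Union>M"
        have "P (insert {x, y} M)"
          using M x y yM by (auto simp: P_def nb_def pairwise_insert disjnt_def)
        moreover have "{x, y} \<notin> M" using x by auto
        ultimately show False using maxM[of "insert {x, y} M"] fin[OF M] by simp
      qed
    qed
    then have nbU: "nb u \<subseteq> \<Union>M" "nb v \<subseteq> \<Union>M" using uv by blast+
    have "\<exists>y. {x, y} \<in> M \<and> x \<noteq> y" if "x \<in> \<Union>M" for x
    proof -
      from that obtain e where e: "e \<in> M" "x \<in> e" by blast
      then have "card e = 2" using M by (simp add: P_def)
      then obtain a b where "e = {a, b}" "a \<noteq> b" by (auto simp: card_2_iff)
      then show ?thesis using e by (auto simp: insert_commute)
    qed
    then obtain mate where mate: "\<And>x. x \<in> \<Union>M \<Longrightarrow> {x, mate x} \<in> M \<and> x \<noteq> mate x" by metis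
    have injm: "inj_on mate (\<Union>M)"
    proof (rule inj_onI)
      fix x y assume xy: "x \<in> \<Union>M" "y \<in> \<Union>M" "mate x = mate y"
      then have "{x, mate x} = {y, mate y}"
        using mate[of x] mate[of y] by (intro disjM[of _ _ "mate x"]) auto
      then show "x = y" using xy(3) mate[OF xy(1)] mate[OF xy(2)] by (auto simp: doubleton_eq_iff)
    qed
    have "mate x \<notin> nb v" if x: "x \<in> nb u" for x
    proof
      assume my: "mate x \<in> nb v"
      let ?y = "mate x"
      have xy: "{x, ?y} \<in> M" "x \<noteq> ?y" using mate[of x] nbU(1) x by auto
      define M0 where "M0 = M - {{x, ?y}}"
      have away: "x \<notin> e" "?y \<notin> e" "u \<notin> e" "v \<notin> e" if "e \<in> M0" for e
        using disjM[of e "{x, ?y}"] that xy uv by (auto simp: M0_def)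
      have xyR: "x \<in> R" "?y \<in> R" "x \<noteq> u" "?y \<noteq> v" "{u, x} \<in> E" "{v, ?y} \<in> E"
        using x my by (auto simp: nb_def)
      have uvn: "u \<noteq> x" "u \<noteq> ?y" "v \<noteq> x" "v \<noteq> ?y" using uv xy by auto
      have "P M0" using M by (auto simp: P_def M0_def intro: pairwise_subset)
      then have "P (insert {u, x} (insert {v, ?y} M0))"
        using xyR away uv uvn xy
        by (auto simp: P_def pairwise_insert disjnt_def doubleton_eq_iff)
      then have "card (insert {u, x} (insert {v, ?y} M0)) \<le> card M" by (rule maxM)
      moreover have "finite M0" using fin[OF M] by (simp add: M0_def)
      moreover have "{v, ?y} \<notin> M0" "{u, x} \<notin> insert {v, ?y} M0"
        using away uv uvn by (auto simp: doubleton_eq_iff)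
      moreover have "card M = Suc (card M0)"
        unfolding M0_def using fin[OF M] xy(1) by (rule card.remove)
      ultimately show False by simp
    qed
    then have "mate ` nb u \<inter> nb v = {}" by auto
    moreover have "mate ` nb u \<subseteq> \<Union>M" using mate nbU(1) by blast
    ultimately have "card (mate ` nb u) + card (nb v) \<le> card (\<Union>M)"
      using nbU(2) finU
      by (metis card_Un_disjoint card_mono finite_subset le_sup_iff)
    moreover have "card (mate ` nb u) = card (nb u)"
      using injm nbU(1) by (meson card_image inj_on_subset)
    moreover have "card R \<le> 2 * card (nb u)" "card R \<le> 2 * card (nb v)"
      using deg uv by (auto simp: nb_def)
    moreover have "card (\<Union>M) + card (R - \<Union>M) = card R"
      using card_Diff_subset[OF finU sub] card_mono[OF R(1) sub] by simp
    ultimately show False using ge2 by linarith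
  qed
  with M show ?thesis by (auto simp: P_def)
qed

lemma greedy_representatives:
  assumes "finite A" "\<And>a. a \<in> A \<Longrightarrow> finite (S a) \<and> card A \<le> card (S a)"
  shows "\<exists>g. inj_on g A \<and> (\<forall>a\<in>A. g a \<in> S a)"
proof -
  have "\<exists>g. inj_on g B \<and> (\<forall>a\<in>B. g a \<in> S a)" if "B \<subseteq> A" for B
    using finite_subset[OF that assms(1)] that
  proof (induction B)
    case (insert b B)
    then obtain g where g: "inj_on g B" "\<forall>a\<in>B. g a \<in> S a" by auto
    have "card (g ` B) \<le> card B" using insert by (intro card_image_le) auto
    also have "\<dots> < card A" using insert assms(1) by (intro psubset_card_mono) auto
    also have "\<dots> \<le> card (S b)" using assms(2)[of b] insert by simp
    finally have "\<not> S b \<subseteq> g ` B" using insert card_mono[of "g ` B" "S b"] by auto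
    then obtain z where z: "z \<in> S b" "z \<notin> g ` B" by blast
    have "inj_on (g(b := z)) (insert b B)"
      using g insert z by (auto simp: inj_on_def)
    moreover have "\<forall>a\<in>insert b B. (g(b := z)) a \<in> S a" using g z by auto
    ultimately show ?case by blast
  qed simp
  then show ?thesis by blast
qed

lemma pairwise_disjnt_Un:
  assumes "pairwise disjnt A" "pairwise disjnt B" "disjnt (\<Union>A) (\<Union>B)"
  shows "pairwise disjnt (A \<union> B)"
proof (rule pairwiseI)
  fix x y assume "x \<in> A \<union> B" "y \<in> A \<union> B" "x \<noteq> y"
  then show "disjnt x y"
    using pairwiseD[OF assms(1), of x y] pairwiseD[OF assms(2), of x y] assms(3)
    by (elim UnE) (auto simp: disjnt_def disjoint_iff)
qed

text \<open>\<open>A\<close> consists of vertices without a prescribed edge whose partners must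
  nevertheless be controlled; they are matched greedily into the reservoir \<open>Z\<close>. At
  least \<open>2 (d + 1)\<close> vertices remain, each nonadjacent to at most \<open>d\<close>
  others, which is Dirac's condition.\<close>

lemma matching_extension:
  assumes W: "finite W" "even (card W)"
    and non: "\<And>v. v \<in> W \<Longrightarrow> card {u \<in> W. u \<noteq> v \<and> {v, u} \<notin> E} \<le> d"
    and Pre: "Pre \<subseteq> E" "pairwise disjnt Pre" "\<Union>Pre \<subseteq> W" "\<And>e. e \<in> Pre \<Longrightarrow> card e = 2"
    and A: "A \<subseteq> W - \<Union>Pre" and Z: "Z \<subseteq> W - \<Union>Pre - A"
    and cZ: "d + card A \<le> card Z"
    and cW: "2 * (d + 1) + 2 * card Pre + 2 * card A \<le> card W"
  obtains F where "Pre \<subseteq> F" "F \<subseteq> E" "pairwise disjnt F" "\<Union>F = W" "\<And>e. e \<in> F \<Longrightarrow> card e = 2"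
    "\<And>a u. a \<in> A \<Longrightarrow> {a, u} \<in> F \<Longrightarrow> u \<in> Z"
proof -
  have finA: "finite A" and finZ: "finite Z"
    using W(1) A Z by (auto intro: finite_subset[of _ W])
  have finPre: "finite Pre"
    by (rule finite_subset[of _ "Pow W"]) (use W(1) Pre(3) in auto)
  have "\<exists>g. inj_on g A \<and> (\<forall>a\<in>A. g a \<in> {z \<in> Z. {a, z} \<in> E})"
  proof (rule greedy_representatives[OF finA])
    fix a assume a: "a \<in> A"
    have "Z - {z \<in> Z. {a, z} \<in> E} \<subseteq> {u \<in> W. u \<noteq> a \<and> {a, u} \<notin> E}" using Z a by auto
    then have "card (Z - {z \<in> Z. {a, z} \<in> E}) \<le> card {u \<in> W. u \<noteq> a \<and> {a, u} \<notin> E}"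
      using W(1) by (intro card_mono) auto
    also have "\<dots> \<le> d" using non A a by auto
    finally have "card Z - card {z \<in> Z. {a, z} \<in> E} \<le> d"
      using finZ by (subst (asm) card_Diff_subset) auto
    then show "finite {z \<in> Z. {a, z} \<in> E} \<and> card A \<le> card {z \<in> Z. {a, z} \<in> E}"
      using cZ finZ by auto
  qed
  then obtain g where g: "inj_on g A" "\<And>a. a \<in> A \<Longrightarrow> g a \<in> Z \<and> {a, g a} \<in> E" by auto
  define F1 where "F1 = (\<lambda>a. {a, g a}) ` A"
  define R where "R = W - \<Union>Pre - A - g ` A"
  have cPre: "card (\<Union>Pre) = 2 * card Pre" using card_Union_two_uniform[OF finPre Pre(2,4)] .
  have finUP: "finite (\<Union>Pre)" using W(1) Pre(3) by (rule finite_subset[rotated])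
  have gZ: "g ` A \<subseteq> Z" using g by auto
  have "R = W - (\<Union>Pre \<union> (A \<union> g ` A))" by (auto simp: R_def)
  moreover have "card (\<Union>Pre \<union> (A \<union> g ` A)) = 2 * card Pre + 2 * card A"
  proof -
    have "A \<inter> g ` A = {}" "\<Union>Pre \<inter> (A \<union> g ` A) = {}" using A Z gZ by auto
    then show ?thesis
      using finA finUP cPre card_image[OF g(1)] by (simp add: card_Un_disjoint)
  qed
  moreover have "\<Union>Pre \<union> (A \<union> g ` A) \<subseteq> W" using A Z gZ Pre(3) by blast
  ultimately have cR: "card R = card W - (2 * card Pre + 2 * card A)"
    using card_Diff_subset[of "\<Union>Pre \<union> (A \<union> g ` A)" W] finA finUP by simp
  have finR: "finite R" using W(1) by (simp add: R_def)
  have "\<exists>M\<subseteq>E. pairwise disjnt M \<and> \<Union>M = R \<and> (\<forall>e\<in>M. card e = 2)"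
  proof (rule dirac_perfect_matching[OF finR])
    show "even (card R)" using W(2) cR by simp
    fix v assume v: "v \<in> R"
    let ?N = "{u \<in> R. u \<noteq> v \<and> {v, u} \<in> E}"
    have "R \<subseteq> insert v ({u \<in> W. u \<noteq> v \<and> {v, u} \<notin> E} \<union> ?N)" by (auto simp: R_def)
    then have "card R \<le> card (insert v ({u \<in> W. u \<noteq> v \<and> {v, u} \<notin> E} \<union> ?N))"
      using W(1) finR by (intro card_mono) auto
    also have "\<dots> \<le> Suc (card {u \<in> W. u \<noteq> v \<and> {v, u} \<notin> E} + card ?N)"
      by (rule order_trans[OF card_insert_le_m1]) (auto simp: card_Un_le)
    also have "\<dots> \<le> Suc (d + card ?N)" using non[of v] v by (simp add: R_def)
    finally have "card R \<le> d + card ?N + 1" by simp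
    moreover have "2 * d + 2 \<le> card R" using cR cW by arith
    ultimately show "card R \<le> 2 * card ?N" by arith
  qed
  then obtain M where M: "M \<subseteq> E" "pairwise disjnt M" "\<Union>M = R" "\<And>e. e \<in> M \<Longrightarrow> card e = 2" by blast
  have F1: "F1 \<subseteq> E" "\<Union>F1 = A \<union> g ` A" using g by (auto simp: F1_def)
  have AZ: "a \<noteq> g a'" if "a \<in> A" "a' \<in> A" for a a' using that g(2)[of a'] Z by auto
  have pF1: "pairwise disjnt F1"
    using g(1) AZ by (auto simp: F1_def pairwise_def disjnt_def inj_on_def)
  have F1c: "card e = 2" if "e \<in> F1" for e using that AZ by (auto simp: F1_def)
  have d1: "disjnt (\<Union>Pre) (\<Union>F1)" "disjnt (\<Union>Pre) (\<Union>M)" "disjnt (\<Union>F1) (\<Union>M)"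
    unfolding F1(2) M(3) using A Z gZ by (auto simp: R_def disjnt_def)
  let ?F = "Pre \<union> F1 \<union> M"
  have "pairwise disjnt ?F"
    using pairwise_disjnt_Un[OF pairwise_disjnt_Un[OF Pre(2) pF1 d1(1)] M(2)] d1(2,3)
    by (auto simp: disjnt_Un1)
  moreover have "\<Union>?F = W"
    using F1(2) M(3) Pre(3) A Z gZ by (auto simp: R_def)
  moreover have "u \<in> Z" if a: "a \<in> A" "{a, u} \<in> ?F" for a u
  proof -
    have "{a, u} \<in> F1" using a A d1 M(3) by (auto simp: R_def)
    then show ?thesis using AZ a g(2) by (auto simp: F1_def doubleton_eq_iff)
  qed
  ultimately show thesis
    using that[of ?F] Pre F1 F1c M by blast
qed

text \<open>Each round is chosen in what the earlier ones left, where after \<open>t\<close> rounds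
  a vertex has at most \<open>r + t\<close> nonneighbors. No round consumes an edge prescribed for a
  later one: at a center, that is, an element of \<open>M\<close>, it uses only an edge prescribed
  for this round or an edge into \<open>Z\<close>, whereas prescribed edges lead from a center to a
  vertex outside \<open>M\<close> and \<open>Z\<close>.\<close>

lemma peel_matchings:
  fixes Pre :: "nat \<Rightarrow> 'a set set"
  assumes V: "finite V" and finM: "finite M"
    and non: "\<And>v. v \<in> V \<Longrightarrow> card {u \<in> V. u \<noteq> v \<and> {v, u} \<notin> E} \<le> r"
    and Pre: "\<And>s. s < T \<Longrightarrow> Pre s \<subseteq> E" "\<And>s. s < T \<Longrightarrow> pairwise disjnt (Pre s)"
      "\<And>s. s < T \<Longrightarrow> \<Union>(Pre s) \<subseteq> W s"
    and Pre_disj: "\<And>s s'. s < T \<Longrightarrow> s' < T \<Longrightarrow> s \<noteq> s' \<Longrightarrow> Pre s \<inter> Pre s' = {}"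
    and form: "\<And>s e. s < T \<Longrightarrow> e \<in> Pre s \<Longrightarrow> \<exists>a\<in>M. \<exists>u. u \<notin> M \<union> Z \<and> e = {a, u}"
    and W: "\<And>s. s < T \<Longrightarrow> W s \<subseteq> V" "\<And>s. s < T \<Longrightarrow> even (card (W s))"
    and Z: "\<And>s. s < T \<Longrightarrow> Z \<subseteq> W s" "Z \<inter> M = {}"
    and cZ: "r + T + card M \<le> card Z"
    and cW: "\<And>s. s < T \<Longrightarrow> 2 * (r + s + 1) + 2 * card (M \<inter> W s) \<le> card (W s)"
  obtains F where
    "\<And>s. s < T \<Longrightarrow> Pre s \<subseteq> F s" "\<And>s. s < T \<Longrightarrow> F s \<subseteq> E"
    "\<And>s. s < T \<Longrightarrow> pairwise disjnt (F s)" "\<And>s. s < T \<Longrightarrow> \<Union>(F s) = W s"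
    "\<And>s a u. s < T \<Longrightarrow> a \<in> M \<Longrightarrow> {a, u} \<in> F s \<Longrightarrow> {a, u} \<in> Pre s \<or> u \<in> Z"
    "\<And>s s'. s < T \<Longrightarrow> s' < T \<Longrightarrow> s \<noteq> s' \<Longrightarrow> F s \<inter> F s' = {}"
proof -
  define ok where "ok s F \<longleftrightarrow> Pre s \<subseteq> F \<and> F \<subseteq> E \<and> pairwise disjnt F \<and> \<Union>F = W s \<and>
    (\<forall>a\<in>M. \<forall>u. {a, u} \<in> F \<longrightarrow> {a, u} \<in> Pre s \<or> u \<in> Z)" for s F
  have "\<exists>F. (\<forall>s<t. ok s (F s)) \<and> (\<forall>s<t. \<forall>s'<t. s \<noteq> s' \<longrightarrow> F s \<inter> F s' = {})" if "t \<le> T" for t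
    using that
  proof (induction t)
    case (Suc t)
    then obtain F where F0: "\<forall>s<t. ok s (F s)"
      "\<forall>s<t. \<forall>s'<t. s \<noteq> s' \<longrightarrow> F s \<inter> F s' = {}" by auto
    then have F: "\<And>s. s < t \<Longrightarrow> ok s (F s)"
      and Fd: "\<And>s s'. s < t \<Longrightarrow> s' < t \<Longrightarrow> s \<noteq> s' \<Longrightarrow> F s \<inter> F s' = {}" by auto
    have t: "t < T" using Suc.prems by simp
    define E' where "E' = E - (\<Union>s<t. F s)"
    define A where "A = M \<inter> W t - \<Union>(Pre t)"
    have finW: "finite (W t)" using W(1)[OF t] V by (rule finite_subset)
    have finA: "finite A" using finM by (simp add: A_def)
    have non': "card {u \<in> W t. u \<noteq> v \<and> {v, u} \<notin> E'} \<le> r + t" if v: "v \<in> W t" for v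
    proof -
      have one: "card {u \<in> W t. {v, u} \<in> F s} \<le> 1" if "s < t" for s
      proof -
        have "u = u'" if u: "{v, u} \<in> F s" "{v, u'} \<in> F s" for u u'
        proof -
          have "pairwise disjnt (F s)" using F[OF \<open>s < t\<close>] by (simp add: ok_def)
          from pairwiseD[OF this u] have "{v, u} = {v, u'}" by (auto simp: disjnt_def)
          then show ?thesis by (auto simp: doubleton_eq_iff)
        qed
        then show ?thesis using finW by (auto simp: card_le_Suc0_iff_eq)
      qed
      have "{u \<in> W t. u \<noteq> v \<and> {v, u} \<notin> E'}
          \<subseteq> {u \<in> V. u \<noteq> v \<and> {v, u} \<notin> E} \<union> (\<Union>s<t. {u \<in> W t. {v, u} \<in> F s})"
        using W(1)[OF t] by (auto simp: E'_def)
      then have "card {u \<in> W t. u \<noteq> v \<and> {v, u} \<notin> E'}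
          \<le> card ({u \<in> V. u \<noteq> v \<and> {v, u} \<notin> E} \<union> (\<Union>s<t. {u \<in> W t. {v, u} \<in> F s}))"
        using V finW by (intro card_mono) auto
      also have "\<dots> \<le> card {u \<in> V. u \<noteq> v \<and> {v, u} \<notin> E} + card (\<Union>s<t. {u \<in> W t. {v, u} \<in> F s})"
        by (rule card_Un_le)
      also have "card (\<Union>s<t. {u \<in> W t. {v, u} \<in> F s}) \<le> (\<Sum>s<t. card {u \<in> W t. {v, u} \<in> F s})"
        by (rule card_UN_le) simp
      also have "\<dots> \<le> (\<Sum>s<t. 1)" using one by (intro sum_mono) auto
      finally show ?thesis using non[of v] v W(1)[OF t] by auto
    qed
    have PreE': "Pre t \<subseteq> E'"
    proof
      fix e assume e: "e \<in> Pre t"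
      have "e \<notin> F s" if s: "s < t" for s
      proof
        assume eF: "e \<in> F s"
        obtain a u where au: "a \<in> M" "u \<notin> M \<union> Z" "e = {a, u}" using form[OF t e] by blast
        then have "e \<in> Pre s" using F[OF s] eF by (auto simp: ok_def)
        then show False using Pre_disj[of s t] s t e by auto
      qed
      then show "e \<in> E'" using Pre(1)[OF t] e by (auto simp: E'_def)
    qed
    have PreC: "card e = 2" if "e \<in> Pre t" for e
      using form[OF t that] card_2_iff by fastforce
    \<comment> \<open>Every prescribed edge occupies a center of its own.\<close>
    have cA: "card (Pre t) + card A \<le> card (M \<inter> W t)"
    proof -
      obtain ce where ce: "\<And>e. e \<in> Pre t \<Longrightarrow> ce e \<in> M \<and> ce e \<in> e"
        using form[OF t] by (metis insertI1)
      have "inj_on ce (Pre t)"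
      proof (rule inj_onI)
        fix e f assume "e \<in> Pre t" "f \<in> Pre t" "ce e = ce f"
        then show "e = f"
          using Pre(2)[OF t] ce unfolding pairwise_def disjnt_def by (metis disjoint_iff)
      qed
      then have "card (Pre t) = card (ce ` Pre t)" by (simp add: card_image)
      moreover have "ce ` Pre t \<inter> A = {}" using ce by (auto simp: A_def)
      moreover have "finite (ce ` Pre t)" "ce ` Pre t \<union> A \<subseteq> M \<inter> W t"
        using ce Pre(3)[OF t] finM by (auto simp: A_def intro: finite_subset[of _ M])
      ultimately show ?thesis
        using card_Un_disjoint[of "ce ` Pre t" A] finA finM card_mono[of "M \<inter> W t" "ce ` Pre t \<union> A"]
        by simp
    qed
    have ZA: "Z \<subseteq> W t - \<Union>(Pre t) - A"
    proof -
      have "z \<notin> e" if "z \<in> Z" "e \<in> Pre t" for z e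
        using form[OF t that(2)] that(1) Z(2) by auto
      then show ?thesis using Z(1)[OF t] Z(2) by (auto simp: A_def)
    qed
    have "card A \<le> card M" using finM by (intro card_mono) (auto simp: A_def)
    then have cZ': "r + t + card A \<le> card Z" using cZ t by linarith
    have cW': "2 * (r + t + 1) + 2 * card (Pre t) + 2 * card A \<le> card (W t)"
      using cW[OF t] cA by linarith
    have AW: "A \<subseteq> W t - \<Union>(Pre t)" by (auto simp: A_def)
    obtain G where G: "Pre t \<subseteq> G" "G \<subseteq> E'" "pairwise disjnt G" "\<Union>G = W t"
      "\<And>a u. a \<in> A \<Longrightarrow> {a, u} \<in> G \<Longrightarrow> u \<in> Z"
      using matching_extension[OF finW W(2)[OF t] non' PreE' Pre(2)[OF t] Pre(3)[OF t] PreC AW ZA cZ' cW']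
      by metis
    have "{a, u} \<in> Pre t \<or> u \<in> Z" if a: "a \<in> M" "{a, u} \<in> G" for a u
    proof (cases "a \<in> A")
      case False
      have "a \<in> W t" using a(2) G(4) by auto
      with False a(1) obtain e where e: "e \<in> Pre t" "a \<in> e" by (auto simp: A_def)
      have "e \<in> G" using e G(1) by auto
      from pairwiseD[OF G(3) this a(2)] have "e = {a, u}" using e by (auto simp: disjnt_def)
      with e show ?thesis by simp
    qed (use G(5) a in blast)
    then have "ok t G" using G unfolding ok_def E'_def by blast
    moreover have "G \<inter> F s = {}" if "s < t" for s using G(2) that by (auto simp: E'_def)
    ultimately have "(\<forall>s<Suc t. ok s ((F(t := G)) s)) \<and>
        (\<forall>s<Suc t. \<forall>s'<Suc t. s \<noteq> s' \<longrightarrow> (F(t := G)) s \<inter> (F(t := G)) s' = {})"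
      using F Fd by (auto simp: less_Suc_eq)
    then show ?case by blast
  qed simp
  from this[of T] obtain F where "\<forall>s<T. ok s (F s)"
    "\<forall>s<T. \<forall>s'<T. s \<noteq> s' \<longrightarrow> F s \<inter> F s' = {}" by auto
  then show thesis using that[of F] unfolding ok_def by blast
qed

section \<open>Rainbow cuts in regular graphs\<close>

lemma two_uniform_simple_graph:
  assumes "simple_graph V E"
  shows "two_uniform E" "\<Union>E \<subseteq> V"
proof -
  have "E \<subseteq> Pow V" using assms by (auto simp: simple_graph_def)
  then have "finite E" using assms by (auto simp: simple_graph_def intro: finite_subset)
  then show "two_uniform E" "\<Union>E \<subseteq> V" using assms by (auto simp: simple_graph_def two_uniform_def)
qed

text \<open>Each of the \<open>s\<close> vertices of \<open>S\<close> has at least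
  \<open>k + 1 - s\<close> neighbors outside, and \<open>s (k + 1 - s) \<ge> k\<close> for
  \<open>1 \<le> s \<le> k\<close>.\<close>

lemma boundary_ge:
  assumes E: "two_uniform E" and reg: "\<And>v. v \<in> S \<Longrightarrow> degree E v = k"
    and S: "finite S" "S \<noteq> {}" "card S \<le> k"
  shows "k \<le> card {e \<in> E. e \<inter> S \<noteq> {} \<and> \<not> e \<subseteq> S}"
proof -
  let ?B = "{e \<in> E. e \<inter> S \<noteq> {} \<and> \<not> e \<subseteq> S}"
  let ?P = "SIGMA x:S. nbrs E x - S"
  have "k + 1 - card S \<le> card (nbrs E x - S)" if "x \<in> S" for x
  proof -
    have "nbrs E x \<inter> S \<subseteq> S - {x}" using two_uniform_neq[OF E, of x x] by auto
    then have "card (nbrs E x \<inter> S) \<le> card S - 1"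
      using card_mono[of "S - {x}"] S(1) that by (simp add: card_Diff_singleton)
    moreover have "card (nbrs E x) = card (nbrs E x \<inter> S) + card (nbrs E x - S)"
      using finite_nbrs[OF E] by (metis card_Int_Diff)
    ultimately show ?thesis
      using reg[OF that] degree_eq_card_nbrs[OF E, of x] S that card_gt_0_iff[of S] by linarith
  qed
  then have "(\<Sum>x\<in>S. k + 1 - card S) \<le> (\<Sum>x\<in>S. card (nbrs E x - S))" by (rule sum_mono)
  also have "\<dots> = card ?P" using S(1) finite_nbrs[OF E] by simp
  also have "\<dots> = card ((\<lambda>(x, y). {x, y}) ` ?P)"
    by (rule card_image[symmetric]) (auto simp: inj_on_def doubleton_eq_iff)
  also have "\<dots> \<le> card ?B"
    using E by (intro card_mono) (auto simp: two_uniform_def)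
  finally have "card S * (k + 1 - card S) \<le> card ?B" by simp
  moreover have "k \<le> card S * (k + 1 - card S)"
  proof -
    obtain a where a: "card S = Suc a" using S by (metis card_gt_0_iff gr0_implies_Suc)
    then obtain d where "k = Suc a + d" using S(3) by (metis le_Suc_ex)
    then show ?thesis using a by (simp add: algebra_simps)
  qed
  ultimately show ?thesis by simp
qed

lemma component_sym:
  "u \<in> V \<Longrightarrow> v \<in> component V E u \<Longrightarrow> component V E v = component V E u"
  unfolding component_def by (auto dest: adj_rel_sym intro: rtrancl_trans)

text \<open>Either the component of \<open>u\<close> or its complement has at most \<open>k\<close>
  vertices, and all edges between the two belong to \<open>R\<close>.\<close>

lemma separating_set_ge:
  assumes V: "finite V" "card V \<le> 2 * k" and E: "two_uniform E" "\<Union>E \<subseteq> V"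
    and reg: "\<And>v. v \<in> V \<Longrightarrow> degree E v = k"
    and R: "R \<subseteq> E" and uv: "u \<in> V" "v \<in> V" "component V (E - R) u \<noteq> component V (E - R) v"
  shows "k \<le> card R"
proof -
  define S where "S = component V (E - R) u"
  have SV: "S \<subseteq> V" "u \<in> S" using uv(1) by (auto simp: S_def component_def)
  have "v \<notin> S" using component_sym[OF uv(1)] uv(3) by (auto simp: S_def)
  have finS: "finite S" using SV(1) V(1) by (rule finite_subset)
  have closed: "y \<in> S" if "{x, y} \<in> E - R" "x \<in> S" for x y
    using that E(2) by (auto simp: S_def component_def adj_rel_def intro: rtrancl_into_rtrancl)
  have crossR: "e \<in> R" if "e \<in> E" "x \<in> e" "y \<in> e" "x \<in> S" "y \<notin> S" for e x y
  proof (rule ccontr)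
    assume "e \<notin> R"
    moreover have "e = {x, y}" using two_uniform_edgeE[OF E(1) that(1,2)] that by auto
    ultimately show False using closed[of x y] that by auto
  qed
  have finR: "finite R" using R E(1) by (auto simp: two_uniform_def intro: finite_subset)
  have "card V = card S + card (V - S)"
    using card_Un_disjoint[of S "V - S"] finS V(1) SV(1) by (simp add: Un_absorb1)
  then consider "card S \<le> k" | "card (V - S) \<le> k" using V(2) by linarith
  then show ?thesis
  proof cases
    case 1
    have "k \<le> card {e \<in> E. e \<inter> S \<noteq> {} \<and> \<not> e \<subseteq> S}"
      using SV by (intro boundary_ge E(1) reg finS 1) auto
    also have "\<dots> \<le> card R" using crossR by (intro card_mono finR) blast
    finally show ?thesis .
  next
    case 2
    have "k \<le> card {e \<in> E. e \<inter> (V - S) \<noteq> {} \<and> \<not> e \<subseteq> V - S}"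
      using \<open>v \<notin> S\<close> uv(2) V(1) by (intro boundary_ge E(1) reg 2) auto
    also have "\<dots> \<le> card R" using crossR E(2) by (intro card_mono finR) blast
    finally show ?thesis .
  qed
qed

lemma rainbow_disconnected_proper:
  assumes E: "two_uniform E" and c: "proper_coloring E c" and V: "2 \<le> card V"
  shows "rainbow_disconnected V E c"
  unfolding rainbow_disconnected_def
proof (intro ballI impI)
  fix u v assume uv: "u \<in> V" "v \<in> V" "u \<noteq> v"
  define R where "R = {e \<in> E. u \<in> e}"
  have cu: "component V (E - R) u = {u}"
  proof -
    have "x = u" if "(u, x) \<in> (adj_rel (E - R))\<^sup>*" for x
    proof (rule ccontr)
      assume "x \<noteq> u"
      with that have "(u, x) \<in> (adj_rel (E - R))\<^sup>*" "u \<noteq> x" by auto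
      then obtain t where "{u, t} \<in> E - R" by (rule adj_rel_first_step)
      then show False by (simp add: R_def)
    qed
    then show ?thesis using uv(1) by (auto simp: component_def)
  qed
  have "V \<noteq> {u}" using V by auto
  then have "edge_cut V E R" using cu uv(1) by (auto simp: edge_cut_def connected_graph_def R_def)
  moreover have "inj_on c R" using proper_coloringD[OF c] by (auto simp: inj_on_def R_def)
  moreover have "v \<in> component V (E - R) v" using uv(2) by (simp add: component_def)
  then have "component V (E - R) u \<noteq> component V (E - R) v" using cu uv(3) by auto
  ultimately show "\<exists>R. uv_rainbow_cut V E c u v R"
    unfolding uv_rainbow_cut_def rainbow_cut_def by blast
qed

lemma rd_regular_eq:
  assumes V: "finite V" "2 \<le> card V" "card V \<le> 2 * k" and E: "two_uniform E" "\<Union>E \<subseteq> V"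
    and reg: "\<And>v. v \<in> V \<Longrightarrow> degree E v = k" and col: "edge_colorable k E"
  shows "rd V E = k"
  unfolding rd_def
proof (rule Least_equality)
  have finE: "finite E" using E(1) by (simp add: two_uniform_def)
  have lower: "k \<le> card (c ` E)" if c: "rainbow_disconnected V E c" for c
  proof -
    obtain u v where uv: "u \<in> V" "v \<in> V" "u \<noteq> v"
      using V(2) card_le_Suc0_iff_eq[OF V(1)] by fastforce
    then obtain R where "uv_rainbow_cut V E c u v R"
      using c unfolding rainbow_disconnected_def by blast
    then have R: "R \<subseteq> E" "inj_on c R" "component V (E - R) u \<noteq> component V (E - R) v"
      unfolding uv_rainbow_cut_def rainbow_cut_def edge_cut_def by auto
    have "k \<le> card R" using separating_set_ge[OF V(1,3) E reg R(1) uv(1,2) R(3)] .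
    also have "\<dots> = card (c ` R)" using card_image[OF R(2)] by simp
    also have "\<dots> \<le> card (c ` E)" using R(1) finE by (intro card_mono) auto
    finally show ?thesis .
  qed
  obtain c where c: "proper_coloring E c" "c ` E \<subseteq> {..<k}"
    using col unfolding edge_colorable_def by blast
  have rc: "rainbow_disconnected V E c" by (rule rainbow_disconnected_proper[OF E(1) c(1) V(2)])
  have "card (c ` E) \<le> k" using card_mono[OF _ c(2)] by simp
  then show "\<exists>c. rainbow_disconnected V E c \<and> card (c ` E) = k"
    using rc lower[OF rc] by (intro exI[of _ c]) simp
  show "k \<le> m" if "\<exists>c. rainbow_disconnected V E c \<and> card (c ` E) = m" for m
    using that lower by auto
qed

section \<open>Regular graphs of high degree\<close>

lemma degree_minus_matchings:
  assumes E: "two_uniform E" and I: "finite I"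
    and F: "\<And>i. i \<in> I \<Longrightarrow> F i \<subseteq> E" "\<And>i. i \<in> I \<Longrightarrow> pairwise disjnt (F i)"
      "\<And>i. i \<in> I \<Longrightarrow> v \<in> \<Union>(F i)"
    and disj: "\<And>i j. i \<in> I \<Longrightarrow> j \<in> I \<Longrightarrow> i \<noteq> j \<Longrightarrow> F i \<inter> F j = {}"
  shows "degree (E - (\<Union>i\<in>I. F i)) v + card I = degree E v"
proof -
  have fin: "finite E" using E by (simp add: two_uniform_def)
  have one: "card {e \<in> F i. v \<in> e} = 1" if i: "i \<in> I" for i
  proof -
    obtain e where e: "e \<in> F i" "v \<in> e" using F(3)[OF i] by blast
    have "f = e" if "f \<in> F i" "v \<in> f" for f
      using pairwiseD[OF F(2)[OF i] that(1) e(1)] that(2) e(2) by (auto simp: disjnt_def)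
    then have "{e \<in> F i. v \<in> e} = {e}" using e by blast
    then show ?thesis by simp
  qed
  let ?A = "{e \<in> E - (\<Union>i\<in>I. F i). v \<in> e}" and ?B = "\<Union>i\<in>I. {e \<in> F i. v \<in> e}"
  have "card ?B = (\<Sum>i\<in>I. card {e \<in> F i. v \<in> e})"
  proof (rule card_UN_disjoint[OF I])
    show "\<forall>i\<in>I. finite {e \<in> F i. v \<in> e}"
      using F(1) fin by (auto intro: finite_subset[of _ E])
    show "\<forall>i\<in>I. \<forall>j\<in>I. i \<noteq> j \<longrightarrow> {e \<in> F i. v \<in> e} \<inter> {e \<in> F j. v \<in> e} = {}"
      using disj by blast
  qed
  then have "card ?B = card I" using one by simp
  moreover have "{e \<in> E. v \<in> e} = ?A \<union> ?B" using F(1) by auto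
  moreover have "card (?A \<union> ?B) = card ?A + card ?B"
    using fin F(1) I by (intro card_Un_disjoint) (auto intro: finite_subset)
  ultimately show ?thesis by (simp add: degree_def)
qed

lemma add_mod_cancel_left:
  fixes s x y T :: nat
  assumes "(s + x) mod T = (s + y) mod T" "x < T" "y < T"
  shows "x = y"
proof -
  have lt: "s mod T < T" using assms(2) by (intro mod_less_divisor) simp
  have "(s mod T + z) mod T = (if s mod T + z < T then s mod T + z else s mod T + z - T)"
    if "z < T" for z
  proof -
    have "s mod T + z - T < T" using lt that by linarith
    then show ?thesis using le_mod_geq[of T "s mod T + z"] mod_less by (metis not_less)
  qed
  moreover have "(s mod T + x) mod T = (s mod T + y) mod T" using assms(1) by (simp add: mod_simps)
  ultimately show ?thesis using assms(2,3) lt by (auto split: if_splits)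
qed

section \<open>Peeling matchings around two nonadjacent vertices\<close>

locale twin_pair =
  fixes V :: "'a set" and E :: "'a set set" and k r :: nat and w b :: 'a
  assumes finV: "finite V" and evenV: "even (card V)"
    and E: "two_uniform E" and EV: "\<Union>E \<subseteq> V" and reg: "\<And>v. v \<in> V \<Longrightarrow> degree E v = k"
    and cardV: "card V = k + r + 1" and high: "7 * (r + 1) \<le> card V"
    and w: "w \<in> V" and b: "b \<in> V" and wb: "w \<noteq> b" "{w, b} \<notin> E"
begin

definition non :: "'a \<Rightarrow> 'a set" where "non v = {u \<in> V. u \<noteq> v \<and> {v, u} \<notin> E}"
definition "C = (non w \<union> non b) - {w, b}"
text \<open>\<open>X\<close> is adjacent to \<open>w\<close> but not to \<open>b\<close>, and
  \<open>Y\<close> to \<open>b\<close> but not to \<open>w\<close>. Without the edges from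
  \<open>w\<close> to \<open>X\<close> and from \<open>b\<close> to \<open>Y\<close>, both vertices
  have neighborhood \<open>N\<close>.\<close>

definition "X = non b - non w - {w}"
definition "Y = non w - non b - {b}"
definition "N = V - {w, b} - C"
definition "q = card X"
text \<open>In \<open>T\<close> rounds a center runs through all residues modulo \<open>T\<close>
  and so meets every vertex of \<open>C\<close>. The summand 2 supplies the indices of
  \<open>w\<close> and \<open>b\<close> besides those of up to \<open>card C\<close> other
  centers.\<close>

definition "T = card C + 2"

lemma finite_non: "finite (non v)" using finV by (simp add: non_def)

lemma card_non: "v \<in> V \<Longrightarrow> card (non v) = r"
proof -
  assume v: "v \<in> V"
  have "y \<in> V" if "{v, y} \<in> E" for y using EV that by blast
  then have sub: "insert v (nbrs E v) \<subseteq> V" using v by auto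
  have "v \<notin> nbrs E v" using two_uniform_neq[OF E, of v v] by auto
  then have "card (insert v (nbrs E v)) = k + 1"
    using finite_nbrs[OF E] reg[OF v] degree_eq_card_nbrs[OF E] by simp
  moreover have "non v = V - insert v (nbrs E v)" by (auto simp: non_def)
  ultimately show ?thesis
    using card_Diff_subset[OF _ sub] finite_nbrs[OF E] cardV by simp
qed

lemma adjacent_iff: "v \<in> V \<Longrightarrow> u \<in> V \<Longrightarrow> {v, u} \<in> E \<longleftrightarrow> u \<noteq> v \<and> u \<notin> non v"
  using two_uniform_neq[OF E, of v u] by (auto simp: non_def)

lemma b_non_w: "b \<in> non w" "w \<in> non b"
  using w b wb by (auto simp: non_def insert_commute)

lemma subsets:
  "C \<subseteq> V" "N \<subseteq> V" "w \<notin> C" "b \<notin> C" "w \<notin> N" "b \<notin> N" "N \<inter> C = {}" "X \<subseteq> C" "Y \<subseteq> C"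
  "X \<inter> Y = {}"
  using w b b_non_w by (auto simp: C_def N_def X_def Y_def non_def)

lemma V_eq: "V = insert w (insert b (N \<union> C))"
  using w b subsets(1) by (auto simp: N_def)

lemma finites: "finite C" "finite N" "finite X" "finite Y"
proof -
  show "finite C" using subsets(1) finV by (rule finite_subset)
  then show "finite X" "finite Y" using subsets(8,9) finite_subset by metis+
  show "finite N" using subsets(2) finV by (rule finite_subset)
qed

text \<open>\<open>non w\<close> and \<open>non b\<close> have \<open>r\<close> elements each. Apart
  from \<open>b\<close> and \<open>w\<close> they differ only in \<open>Y\<close> and
  \<open>X\<close>, which are therefore equally large, and \<open>C\<close> has
  \<open>r - 1 + q \<le> 2 r - 2\<close> elements.\<close>

lemma card_parts:
  obtains "r \<ge> 1" "q + 1 \<le> r" "card Y = q" "card C + 1 = r + q" "card N + card C + 2 = card V"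
proof -
  let ?W = "non w \<inter> non b"
  have w_eq: "non w = insert b (Y \<union> ?W)" and b_eq: "non b = insert w (X \<union> ?W)"
    and C_eq: "C = X \<union> ?W \<union> Y"
    using b_non_w by (auto simp: Y_def X_def C_def non_def)
  have nin: "b \<notin> Y \<union> ?W" "w \<notin> X \<union> ?W" by (auto simp: Y_def X_def non_def)
  have disj: "Y \<inter> ?W = {}" "X \<inter> ?W = {}" "(X \<union> ?W) \<inter> Y = {}" by (auto simp: X_def Y_def)
  have fW: "finite ?W" using finite_non by simp
  have "card (Y \<union> ?W) = card Y + card ?W" "card (X \<union> ?W) = card X + card ?W"
    using card_Un_disjoint[OF finites(4) fW disj(1)] card_Un_disjoint[OF finites(3) fW disj(2)]
    by blast+
  moreover from this have "card (X \<union> ?W \<union> Y) = card X + card ?W + card Y"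
    using card_Un_disjoint[OF _ finites(4) disj(3)] finites fW by (simp only: finite_Un)
  moreover have "card (non w) = Suc (card (Y \<union> ?W))"
    by (subst w_eq) (use nin finites finite_non in simp)
  moreover have "card (non b) = Suc (card (X \<union> ?W))"
    by (subst b_eq) (use nin finites finite_non in simp)
  ultimately have 1: "Suc (card Y + card ?W) = r" "Suc (q + card ?W) = r"
    "card C = q + card ?W + card Y"
    using card_non[OF w] card_non[OF b] C_eq by (simp_all add: q_def)
  have "card V = card (insert w (insert b (N \<union> C)))" using V_eq by simp
  also have "\<dots> = card N + card C + 2"
  proof -
    have "w \<notin> insert b (N \<union> C)" "b \<notin> N \<union> C" using subsets wb(1) by auto
    then show ?thesis using finites card_Un_disjoint[OF finites(2,1) subsets(7)] by simp
  qed
  finally show thesis using that 1 by linarith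
qed

text \<open>The order is \<open>X\<close>, then the common nonneighbors, then \<open>Y\<close>. The
  first two groups together have \<open>r - 1\<close> elements, so \<open>Y\<close> starts at index
  \<open>r - 1\<close>.\<close>

lemma leaf_enumeration:
  obtains u where "bij_betw u {..<card C} C" "\<And>i. i < card C \<Longrightarrow> u i \<in> X \<longleftrightarrow> i < q"
    "\<And>i. i < card C \<Longrightarrow> u i \<in> Y \<longleftrightarrow> r \<le> i + 1"
proof -
  obtain xs where xs: "set xs = X" "distinct xs" using finite_distinct_list[OF finites(3)] by blast
  obtain ys where ys: "set ys = Y" "distinct ys" using finite_distinct_list[OF finites(4)] by blast
  have "finite (C - X - Y)" using finites by simp
  then obtain zs where zs: "set zs = C - X - Y" "distinct zs"
    using finite_distinct_list by blast
  define l where "l = xs @ zs @ ys"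
  have l: "distinct l" "set l = C" using xs ys zs subsets(8-10) by (auto simp: l_def)
  have len: "length l = card C" using distinct_card[OF l(1)] l(2) by simp
  have lx: "length xs = q" "length ys = card Y"
    using distinct_card[OF xs(2)] distinct_card[OF ys(2)] xs(1) ys(1) by (simp_all add: q_def)
  have bij: "bij_betw ((!) l) {..<card C} C"
    by (rule bij_betw_nth[OF l(1)]) (use l len in simp_all)
  have X: "l ! i \<in> X \<longleftrightarrow> i < q" if i: "i < card C" for i
  proof (cases "i < q")
    case True
    then have "l ! i = xs ! i" using lx by (simp add: l_def nth_append)
    then have "l ! i \<in> set xs" using True lx by simp
    then show ?thesis using True xs by simp
  next
    case False
    then have "l ! i = (zs @ ys) ! (i - q)" using lx by (simp add: l_def nth_append)
    moreover have "i - q < length (zs @ ys)" using False i len lx by (auto simp: l_def)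
    ultimately have "l ! i \<in> set (zs @ ys)" by (metis nth_mem)
    then show ?thesis using False zs ys subsets(10) by auto
  qed
  have Y: "l ! i \<in> Y \<longleftrightarrow> r \<le> i + 1" if i: "i < card C" for i
  proof -
    obtain "card Y = q" "card C + 1 = r + q" by (rule card_parts)
    moreover have "length (xs @ zs) + card Y = card C" using len lx by (simp add: l_def)
    ultimately have lz: "length (xs @ zs) + 1 = r" by linarith
    have l_eq: "l = (xs @ zs) @ ys" by (simp add: l_def)
    show ?thesis
    proof (cases "i < length (xs @ zs)")
      case True
      then have "l ! i = (xs @ zs) ! i" by (simp only: l_eq nth_append if_True)
      then have "l ! i \<in> set (xs @ zs)" using True by (metis nth_mem)
      then show ?thesis using True lz xs zs subsets(10) by auto
    next
      case False
      then have "l ! i = ys ! (i - length (xs @ zs))" by (simp only: l_eq nth_append if_False)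
      moreover have "i - length (xs @ zs) < length ys" using False i len by (auto simp: l_def)
      ultimately have "l ! i \<in> set ys" by (metis nth_mem)
      then show ?thesis using False lz ys by auto
    qed
  qed
  show thesis using that[of "(!) l"] bij X Y by blast
qed

text \<open>The prescribed edges of round \<open>s\<close> join a center with index \<open>j\<close> to leaf number \<open>s + j\<close> modulo
  \<open>T\<close>. The centers \<open>w\<close> and \<open>b\<close> have indices \<open>0\<close> and \<open>r - 1\<close>, so that \<open>w\<close> loses \<open>X\<close>
  and \<open>b\<close> loses \<open>Y\<close> in the same rounds \<open>s < q\<close>.\<close>

lemma peel:
  assumes A: "A \<subseteq> N" "card A \<le> card C" "2 * (card A + r + card C + 3) \<le> card V"
  obtains F where
    "\<And>s. s < T \<Longrightarrow> F s \<subseteq> E" "\<And>s. s < T \<Longrightarrow> pairwise disjnt (F s)"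
    "\<And>s. s < T \<Longrightarrow> \<Union>(F s) = (if s < q then V else V - {w, b})"
    "\<And>s s'. s < T \<Longrightarrow> s' < T \<Longrightarrow> s \<noteq> s' \<Longrightarrow> F s \<inter> F s' = {}"
    "\<And>v. (\<exists>s<T. {w, v} \<in> F s) \<longleftrightarrow> v \<in> X" "\<And>v. (\<exists>s<T. {b, v} \<in> F s) \<longleftrightarrow> v \<in> Y"
    "\<And>a v. a \<in> A \<Longrightarrow> v \<in> C \<Longrightarrow> {a, v} \<in> E \<Longrightarrow> (\<exists>s<T. {a, v} \<in> F s) \<longleftrightarrow> v \<notin> keep a"
proof -
  obtain cp: "r \<ge> 1" "q + 1 \<le> r" "card Y = q" "card C + 1 = r + q" "card N + card C + 2 = card V"
    by (rule card_parts)
  obtain u where u: "bij_betw u {..<card C} C" and uX: "\<And>i. i < card C \<Longrightarrow> u i \<in> X \<longleftrightarrow> i < q"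
    and uY: "\<And>i. i < card C \<Longrightarrow> u i \<in> Y \<longleftrightarrow> r \<le> i + 1"
    by (rule leaf_enumeration) blast
  have uC: "u i \<in> C" if "i < card C" for i using bij_betwE[OF u] that by auto
  have uinj: "i = j" if "u i = u j" "i < card C" "j < card C" for i j
    using u that by (auto simp: bij_betw_def inj_on_def)
  have usurj: "\<exists>i<card C. v = u i" if "v \<in> C" for v
    using u that by (auto simp: bij_betw_def)
  have finA: "finite A" using A(1) finites by (auto intro: finite_subset)
  have wA: "w \<notin> A" "b \<notin> A" using A(1) subsets by auto
  have rT: "r - 1 < T" "0 < T" using cp by (auto simp: T_def)
  have "card {..<T} \<le> card ({..<T} - {0, r - 1}) + card {0, r - 1}"
    by (rule order_trans[OF card_mono card_Un_le]) auto
  moreover have "card {0, r - 1} \<le> 2" by (simp add: card_insert_if)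
  ultimately have "card C \<le> card ({..<T} - {0, r - 1})" by (simp add: T_def)
  then obtain e where e: "e ` A \<subseteq> {..<T} - {0, r - 1}" "inj_on e A"
    using card_le_inj[OF finA, of "{..<T} - {0, r - 1}"] A(2) by (metis finite_Diff finite_lessThan le_trans)
  define idx where "idx = e(w := 0, b := r - 1)"
  define M where "M = insert w (insert b A)"
  have finM: "finite M" using finA by (simp add: M_def)
  have MC: "M \<inter> C = {}" "M \<subseteq> V" using A(1) subsets w b by (auto simp: M_def)
  have idxA: "idx a = e a" if "a \<in> A" for a using that wA by (auto simp: idx_def)
  have idxw: "idx w = 0" "idx b = r - 1" using wb by (auto simp: idx_def)
  have idxT: "idx a < T" if "a \<in> M" for a
    using that rT e(1) idxA idxw by (auto simp: M_def)
  \<comment> \<open>The leaves that a center has to lose. An edge to a kept leaf is never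
    prescribed, and as centers are otherwise matched into \<open>Z\<close>, it survives all
    rounds.\<close>
  define tgt where "tgt a = (if a = w then X else if a = b then Y else C - keep a)" for a
  define lf where "lf s a = (s + idx a) mod T" for s a
  define Pre where "Pre s = {{a, u (lf s a)} | a. a \<in> M \<and> lf s a < card C \<and>
      u (lf s a) \<in> tgt a \<and> {a, u (lf s a)} \<in> E}" for s
  define W where "W s = (if s < q then V else V - {w, b})" for s
  define Z where "Z = N - A"
  \<comment> \<open>For \<open>r = 1\<close> the centers \<open>w\<close> and \<open>b\<close> share
    index 0. This does no harm, because their targets \<open>X\<close> and \<open>Y\<close> are
    disjoint.\<close>
  have lf_inj: "a = a' \<or> {a, a'} = {w, b}" if "lf s a = lf s a'" "a \<in> M" "a' \<in> M" for s a a'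
  proof -
    have "idx a = idx a'"
      using add_mod_cancel_left[of s "idx a" T "idx a'"] that idxT by (auto simp: lf_def)
    moreover have "x \<in> {w, b} \<Longrightarrow> idx x \<in> {0, r - 1}" for x using idxw by auto
    moreover have "x \<in> A \<Longrightarrow> idx x \<notin> {0, r - 1}" for x using e(1) idxA[of x] by auto
    moreover have "a \<in> A \<or> a \<in> {w, b}" "a' \<in> A \<or> a' \<in> {w, b}"
      using that(2,3) by (auto simp: M_def)
    moreover have "a = a'" if "a \<in> A" "a' \<in> A"
      using inj_onD[OF e(2) _ that] idxA that \<open>idx a = idx a'\<close> by simp
    ultimately have "a = a' \<or> a \<in> {w, b} \<and> a' \<in> {w, b}" by metis
    then show ?thesis by auto
  qed
  have lf_s: "s = s'" if "lf s a = lf s' a" "s < T" "s' < T" for s s' a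
    using add_mod_cancel_left[of "idx a" s T s'] that by (auto simp: lf_def add.commute)
  have lfw: "lf s w = s" if "s < T" for s using that by (simp add: lf_def idxw)
  \<comment> \<open>From round \<open>q\<close> on, the leaf number of \<open>b\<close> is at least
    \<open>card C\<close> or has wrapped around to a value below \<open>r - 1\<close>, so
    \<open>b\<close> no longer meets \<open>Y\<close>.\<close>
  have lfb: "lf s b < card C \<and> r \<le> lf s b + 1 \<longleftrightarrow> s < q" if "s < T" for s
  proof (cases "s + (r - 1) < T")
    case True
    then show ?thesis using cp by (auto simp: lf_def idxw T_def)
  next
    case False
    then have "lf s b = s + (r - 1) - T" using that rT by (simp add: lf_def idxw mod_if)
    then show ?thesis using False that cp by (auto simp: T_def)
  qed
  have lfb_q: "lf s b = s + (r - 1)" if "s < q" for s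
    using that cp by (simp add: lf_def idxw T_def)
  have qC: "q \<le> card C" "q \<le> T" using cp by (auto simp: T_def)
  have PreI: "{a, u (lf s a)} \<in> Pre s"
    if "a \<in> M" "lf s a < card C" "u (lf s a) \<in> tgt a" "{a, u (lf s a)} \<in> E" for s a
    using that by (auto simp: Pre_def)
  have PreE: thesis
    if "f \<in> Pre s" "\<And>a. f = {a, u (lf s a)} \<Longrightarrow> a \<in> M \<Longrightarrow> lf s a < card C \<Longrightarrow> u (lf s a) \<in> C
      \<Longrightarrow> u (lf s a) \<notin> M \<Longrightarrow> u (lf s a) \<in> tgt a \<Longrightarrow> f \<in> E \<Longrightarrow> thesis" for s f thesis
    using that uC MC(1) unfolding Pre_def by blast
  have wPre: "s < q" if "f \<in> Pre s" "w \<in> f" "s < T" for s f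
    using that(1)
  proof (rule PreE)
    fix a assume a: "f = {a, u (lf s a)}" "lf s a < card C" "u (lf s a) \<in> C" "u (lf s a) \<in> tgt a"
    then have "a = w" using that(2) subsets(3) by auto
    then show ?thesis using a uX[OF a(2)] lfw[OF that(3)] by (simp add: tgt_def)
  qed
  have bPre: "s < q" if "f \<in> Pre s" "b \<in> f" "s < T" for s f
    using that(1)
  proof (rule PreE)
    fix a assume a: "f = {a, u (lf s a)}" "lf s a < card C" "u (lf s a) \<in> C" "u (lf s a) \<in> tgt a"
    then have "a = b" using that(2) subsets(4) by auto
    then show ?thesis using a uY[OF a(2)] lfb[OF that(3)] wb(1) by (simp add: tgt_def)
  qed
  have non_le: "card {x \<in> V. x \<noteq> v \<and> {v, x} \<notin> E} \<le> r" if "v \<in> V" for v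
    using card_non[OF that] by (simp add: non_def)
  have Pre_disj1: "pairwise disjnt (Pre s)" for s
  proof (rule pairwiseI)
    fix f g assume f: "f \<in> Pre s" and g: "g \<in> Pre s" and ne: "f \<noteq> g"
    from f show "disjnt f g"
    proof (rule PreE)
      fix a assume a: "f = {a, u (lf s a)}" "a \<in> M" "lf s a < card C" "u (lf s a) \<notin> M"
        "u (lf s a) \<in> tgt a"
      from g show ?thesis
      proof (rule PreE)
        fix a' assume a': "g = {a', u (lf s a')}" "a' \<in> M" "lf s a' < card C" "u (lf s a') \<notin> M"
          "u (lf s a') \<in> tgt a'"
        have "u (lf s a) \<noteq> u (lf s a')"
        proof
          assume eq: "u (lf s a) = u (lf s a')"
          then have "lf s a = lf s a'" using uinj a(3) a'(3) by blast
          then have "a = a' \<or> {a, a'} = {w, b}" using lf_inj a(2) a'(2) by blast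
          then show False
            using ne a a' eq subsets(10) by (auto simp: doubleton_eq_iff tgt_def split: if_splits)
        qed
        then show ?thesis using a a' ne by (auto simp: disjnt_def)
      qed
    qed
  qed
  have PreW: "\<Union>(Pre s) \<subseteq> W s" if "s < T" for s
  proof
    fix x assume "x \<in> \<Union>(Pre s)"
    then obtain f where f: "f \<in> Pre s" "x \<in> f" by blast
    then have "x \<in> V" using EV by (auto simp: Pre_def)
    then show "x \<in> W s" using wPre[OF f(1) _ that] bPre[OF f(1) _ that] f(2) by (auto simp: W_def)
  qed
  have Pre_disj2: "Pre s \<inter> Pre s' = {}" if "s < T" "s' < T" "s \<noteq> s'" for s s'
  proof (rule ccontr)
    assume "Pre s \<inter> Pre s' \<noteq> {}"
    then obtain f where f: "f \<in> Pre s" "f \<in> Pre s'" by blast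
    from f(1) show False
    proof (rule PreE)
      fix a assume a: "f = {a, u (lf s a)}" "a \<in> M" "lf s a < card C" "u (lf s a) \<notin> M"
      from f(2) show False
      proof (rule PreE)
        fix a' assume a': "f = {a', u (lf s' a')}" "a' \<in> M" "lf s' a' < card C" "u (lf s' a') \<notin> M"
        have "a = a'" "u (lf s a) = u (lf s' a')" using a a' by (auto simp: doubleton_eq_iff)
        then show False using uinj[of "lf s a" "lf s' a'"] a(3) a'(3) lf_s[of s a s'] that by auto
      qed
    qed
  qed
  have form: "\<exists>a\<in>M. \<exists>x. x \<notin> M \<union> Z \<and> f = {a, x}" if "f \<in> Pre s" for s f
    using that
  proof (rule PreE)
    fix a assume a: "f = {a, u (lf s a)}" "a \<in> M" "u (lf s a) \<in> C" "u (lf s a) \<notin> M"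
    then have "u (lf s a) \<notin> Z" using subsets(7) by (auto simp: Z_def)
    then show ?thesis using a by blast
  qed
  have cM: "card M \<le> card A + 2" by (simp add: M_def finA card_insert_if)
  have card_wb: "card (V - {w, b}) + 2 = card V"
    using finV w b wb(1) card_mono[OF finV, of "{w, b}"] by (simp add: card_Diff_subset)
  obtain F where F: "\<And>s. s < T \<Longrightarrow> Pre s \<subseteq> F s" "\<And>s. s < T \<Longrightarrow> F s \<subseteq> E"
    "\<And>s. s < T \<Longrightarrow> pairwise disjnt (F s)" "\<And>s. s < T \<Longrightarrow> \<Union>(F s) = W s"
    "\<And>s a u. s < T \<Longrightarrow> a \<in> M \<Longrightarrow> {a, u} \<in> F s \<Longrightarrow> {a, u} \<in> Pre s \<or> u \<in> Z"
    "\<And>s s'. s < T \<Longrightarrow> s' < T \<Longrightarrow> s \<noteq> s' \<Longrightarrow> F s \<inter> F s' = {}"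
  proof (rule peel_matchings[of V M E r T Pre W Z])
    show "finite V" by (rule finV)
    show "finite M" by (rule finM)
    show "card {u \<in> V. u \<noteq> v \<and> {v, u} \<notin> E} \<le> r" if "v \<in> V" for v by (rule non_le[OF that])
    show "Pre s \<subseteq> E" for s by (auto simp: Pre_def)
    show "pairwise disjnt (Pre s)" for s by (rule Pre_disj1)
    show "\<Union>(Pre s) \<subseteq> W s" if "s < T" for s by (rule PreW[OF that])
    show "Pre s \<inter> Pre s' = {}" if "s < T" "s' < T" "s \<noteq> s'" for s s' by (rule Pre_disj2[OF that])
    show "\<exists>a\<in>M. \<exists>u. u \<notin> M \<union> Z \<and> f = {a, u}" if "f \<in> Pre s" for s f by (rule form[OF that])
    show "W s \<subseteq> V" for s by (auto simp: W_def)
    show "even (card (W s))" for s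
      using evenV card_wb even_add[of "card (V - {w, b})" 2] by (simp add: W_def)
    show "Z \<subseteq> W s" for s using subsets by (auto simp: Z_def W_def)
    show "Z \<inter> M = {}" using subsets by (auto simp: Z_def M_def)
    have "card Z = card N - card A" using A(1) finA by (simp add: Z_def card_Diff_subset)
    then show "r + T + card M \<le> card Z" using cM A(3) cp by (simp add: T_def)
    fix s assume s: "s < T"
    show "2 * (r + s + 1) + 2 * card (M \<inter> W s) \<le> card (W s)"
    proof (cases "s < q")
      case True
      have "card (M \<inter> W s) \<le> card M" using finM by (intro card_mono) auto
      then show ?thesis using True cM A(3) cp by (simp add: W_def)
    next
      case False
      have "card (M \<inter> W s) \<le> card A" using False finA by (intro card_mono) (auto simp: W_def M_def)
      then show ?thesis using False s A(3) card_wb by (simp add: W_def T_def)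
    qed
  qed (blast intro: that)+
  have F_unique: "x = y" if "s < T" "{v, x} \<in> F s" "{v, y} \<in> F s" for s v x y
    using pairwiseD[OF F(3)[OF that(1)] that(2,3)] by (auto simp: disjnt_def doubleton_eq_iff)
  have wX: "(\<exists>s<T. {w, v} \<in> F s) \<longleftrightarrow> v \<in> X" for v
  proof -
    have pre: "{w, u s} \<in> F s" if "s < q" for s
    proof -
      have s: "s < card C" "s < T" using that qC by auto
      have "u s \<in> X" using uX[OF s(1)] that by simp
      then have "{w, u s} \<in> E" using adjacent_iff[OF w, of "u s"] subsets by (auto simp: X_def)
      then show ?thesis using PreI[of w s] lfw[OF s(2)] s \<open>u s \<in> X\<close> F(1)[OF s(2)]
        by (auto simp: M_def tgt_def)
    qed
    show ?thesis
    proof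
      assume "\<exists>s<T. {w, v} \<in> F s"
      then obtain s where s: "s < T" "{w, v} \<in> F s" by blast
      then have "s < q" using F(4)[OF s(1)] by (auto simp: W_def split: if_splits)
      then have "v = u s" using F_unique[OF s(1) s(2) pre] by simp
      then show "v \<in> X" using uX[of s] \<open>s < q\<close> qC by simp
    next
      assume "v \<in> X"
      then obtain i where i: "i < card C" "v = u i" using usurj subsets by blast
      then have "i < q" using uX \<open>v \<in> X\<close> by simp
      then show "\<exists>s<T. {w, v} \<in> F s" using pre[of i] i qC by (intro exI[of _ i]) auto
    qed
  qed
  have bY: "(\<exists>s<T. {b, v} \<in> F s) \<longleftrightarrow> v \<in> Y" for v
  proof -
    have pre: "{b, u (s + (r - 1))} \<in> F s" if "s < q" for s
    proof -
      have s: "s + (r - 1) < card C" "s < T" using that cp by (auto simp: T_def)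
      have uy: "u (s + (r - 1)) \<in> Y" using uY[OF s(1)] by simp
      then have "{b, u (s + (r - 1))} \<in> E"
        using adjacent_iff[OF b, of "u (s + (r - 1))"] subsets by (auto simp: Y_def)
      then show ?thesis using PreI[of b s] lfb_q[OF that] s uy F(1)[OF s(2)] wb(1)
        by (auto simp: M_def tgt_def)
    qed
    show ?thesis
    proof
      assume "\<exists>s<T. {b, v} \<in> F s"
      then obtain s where s: "s < T" "{b, v} \<in> F s" by blast
      then have "s < q" using F(4)[OF s(1)] by (auto simp: W_def split: if_splits)
      then have "v = u (s + (r - 1))" using F_unique[OF s(1) s(2) pre] by simp
      then show "v \<in> Y" using uY[of "s + (r - 1)"] \<open>s < q\<close> cp by simp
    next
      assume "v \<in> Y"
      then obtain i where i: "i < card C" "v = u i" using usurj subsets by blast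
      then have "r \<le> i + 1" using uY \<open>v \<in> Y\<close> by simp
      then have "i + 1 - r < q" "i + 1 - r + (r - 1) = i" using i cp by auto
      then show "\<exists>s<T. {b, v} \<in> F s"
        using pre[of "i + 1 - r"] i qC by (intro exI[of _ "i + 1 - r"]) auto
    qed
  qed
  have aC: "(\<exists>s<T. {a, v} \<in> F s) \<longleftrightarrow> v \<notin> keep a" if a: "a \<in> A" "v \<in> C" "{a, v} \<in> E" for a v
  proof
    assume "\<exists>s<T. {a, v} \<in> F s"
    then obtain s where s: "s < T" "{a, v} \<in> F s" by blast
    have "v \<notin> Z" "a \<in> M" using a subsets by (auto simp: Z_def M_def)
    then have "{a, v} \<in> Pre s" using F(5)[OF s(1) _ s(2)] by blast
    then show "v \<notin> keep a"
    proof (rule PreE)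
      fix a' assume a': "{a, v} = {a', u (lf s a')}" "u (lf s a') \<notin> M" "u (lf s a') \<in> tgt a'"
      then have "a = a'" "v = u (lf s a')" using \<open>a \<in> M\<close> by (auto simp: doubleton_eq_iff)
      moreover have "a \<noteq> w" "a \<noteq> b" using a(1) wA by auto
      ultimately show ?thesis using a'(3) by (simp add: tgt_def)
    qed
  next
    assume nk: "v \<notin> keep a"
    obtain i where i: "i < card C" "v = u i" using usurj a by blast
    have aM: "a \<in> M" using a by (simp add: M_def)
    \<comment> \<open>The round in which \<open>a\<close> meets leaf \<open>i\<close>, that is, the
      solution of \<open>s + idx a = i\<close> modulo \<open>T\<close>.\<close>
    define s where "s = (i + (T - idx a)) mod T"
    have "s < T" using rT(2) by (simp add: s_def)
    have "lf s a = (i + (T - idx a) + idx a) mod T" by (simp add: lf_def s_def mod_simps)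
    also have "\<dots> = (i + T) mod T" using idxT[OF aM] by simp
    also have "\<dots> = i" using i by (simp only: mod_add_self2) (simp add: T_def)
    finally have "lf s a = i" .
    then have "{a, v} \<in> Pre s"
    proof -
      have "a \<noteq> w" "a \<noteq> b" using a(1) wA by auto
      then show ?thesis using PreI[OF aM, of s] i a nk \<open>lf s a = i\<close> by (simp add: tgt_def)
    qed
    then show "\<exists>s<T. {a, v} \<in> F s" using F(1)[OF \<open>s < T\<close>] \<open>s < T\<close> by blast
  qed
  show thesis
    using that[of F] F(2,3,6) F(4)[unfolded W_def] wX bY aC by blast
qed

end

section \<open>Coloring what the matchings leave\<close>

text \<open>This fixes the outcome of \<open>peel\<close>, which is used for two choices of
  \<open>A\<close>: the empty set when \<open>C\<close> has at most two elements, and the chosen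
  vertices otherwise.\<close>

locale peeled = twin_pair +
  fixes A :: "'a set" and keep :: "'a \<Rightarrow> 'a set" and F :: "nat \<Rightarrow> 'a set set"
  assumes AN: "A \<subseteq> N"
    and F_sub: "\<And>s. s < T \<Longrightarrow> F s \<subseteq> E" and F_pw: "\<And>s. s < T \<Longrightarrow> pairwise disjnt (F s)"
    and F_cover: "\<And>s. s < T \<Longrightarrow> \<Union>(F s) = (if s < q then V else V - {w, b})"
    and F_disj: "\<And>s s'. s < T \<Longrightarrow> s' < T \<Longrightarrow> s \<noteq> s' \<Longrightarrow> F s \<inter> F s' = {}"
    and F_w: "\<And>v. (\<exists>s<T. {w, v} \<in> F s) \<longleftrightarrow> v \<in> X"
    and F_b: "\<And>v. (\<exists>s<T. {b, v} \<in> F s) \<longleftrightarrow> v \<in> Y"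
    and F_A: "\<And>a v. a \<in> A \<Longrightarrow> v \<in> C \<Longrightarrow> {a, v} \<in> E \<Longrightarrow> (\<exists>s<T. {a, v} \<in> F s) \<longleftrightarrow> v \<notin> keep a"
begin

definition "E1 = E - (\<Union>s\<in>{..<T}. F s)"
definition "E2 = {e \<in> E1. w \<notin> e \<and> b \<notin> e}"

lemma two_uniform_sub: "two_uniform E1" "two_uniform E2"
  using two_uniform_subset[OF E] by (auto simp: E1_def E2_def)

lemma size_bounds:
  "q + 1 \<le> r" "card C + 1 = r + q" "card N + card C + 2 = card V" "q \<le> T" "T + 4 \<le> k"
proof -
  obtain "r \<ge> 1" "q + 1 \<le> r" "card Y = q" "card C + 1 = r + q" "card N + card C + 2 = card V"
    by (rule card_parts)
  then show "q + 1 \<le> r" "card C + 1 = r + q" "card N + card C + 2 = card V" "q \<le> T" "T + 4 \<le> k"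
    using high cardV by (auto simp: T_def)
qed

lemma degree_E1:
  assumes "v \<in> N \<union> C"
  shows "degree E1 v + T = k"
proof -
  have v: "v \<in> V" "v \<noteq> w" "v \<noteq> b" using assms subsets by auto
  have "degree (E - (\<Union>s\<in>{..<T}. F s)) v + card {..<T} = degree E v"
    by (rule degree_minus_matchings[OF E]) (use F_sub F_pw F_cover F_disj v in auto)
  then show ?thesis using reg[OF v(1)] by (simp add: E1_def)
qed

lemma E1_wb:
  "v \<in> C \<Longrightarrow> {w, v} \<notin> E1 \<and> {b, v} \<notin> E1"
  "v \<in> N \<Longrightarrow> {w, v} \<in> E1 \<and> {b, v} \<in> E1"
proof -
  assume v: "v \<in> C"
  then have vV: "v \<in> V" using subsets by auto
  have "v \<in> X \<or> v \<in> non w" "v \<in> Y \<or> v \<in> non b" using v by (auto simp: C_def X_def Y_def)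
  then show "{w, v} \<notin> E1 \<and> {b, v} \<notin> E1"
    using F_w[of v] F_b[of v] adjacent_iff[OF w vV] adjacent_iff[OF b vV] by (auto simp: E1_def)
next
  assume v: "v \<in> N"
  then have "v \<in> V" "v \<noteq> w" "v \<noteq> b" "v \<notin> non w" "v \<notin> non b" "v \<notin> X" "v \<notin> Y"
    using subsets by (auto simp: N_def C_def)
  then show "{w, v} \<in> E1 \<and> {b, v} \<in> E1"
    using F_w[of v] F_b[of v] adjacent_iff[OF w, of v] adjacent_iff[OF b, of v]
    by (auto simp: E1_def)
qed

text \<open>In \<open>E1\<close> both \<open>w\<close> and \<open>b\<close> are joined to all of
  \<open>N\<close> and to nothing in \<open>C\<close>. So the vertices of \<open>N\<close> have two
  colors to spare, which is the initial slack for all further deletions.\<close>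

lemma degree_E2:
  "v \<in> C \<Longrightarrow> degree E2 v + T = k"
  "v \<in> N \<Longrightarrow> degree E2 v + T + 2 = k"
  "v \<notin> N \<union> C \<Longrightarrow> degree E2 v = 0"
proof -
  have split: "{e \<in> E1. v \<in> e} = {e \<in> E2. v \<in> e} \<union> ({{w, v}, {b, v}} \<inter> E1)"
    if "v \<noteq> w" "v \<noteq> b" for v
  proof (intro set_eqI iffI)
    fix e assume e: "e \<in> {e \<in> E1. v \<in> e}"
    have "x \<in> e \<Longrightarrow> x \<noteq> v \<Longrightarrow> e = {x, v}" for x
      using two_uniform_edgeE[OF two_uniform_sub(1), of e x] e by auto
    from this[of w] this[of b] show "e \<in> {e \<in> E2. v \<in> e} \<union> ({{w, v}, {b, v}} \<inter> E1)"
      using e that by (auto simp: E2_def)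
  qed (auto simp: E2_def)
  have fin: "finite {e \<in> E2. v \<in> e}" for v
    using two_uniform_sub(2) by (simp add: two_uniform_def)
  show "degree E2 v + T = k" if v: "v \<in> C"
  proof -
    have "v \<noteq> w" "v \<noteq> b" using v subsets by auto
    from split[OF this] have "degree E1 v = degree E2 v"
      using E1_wb(1)[OF v] by (simp add: degree_def)
    then show ?thesis using degree_E1[of v] v by simp
  qed
  show "degree E2 v + T + 2 = k" if v: "v \<in> N"
  proof -
    have ne: "v \<noteq> w" "v \<noteq> b" using v subsets by auto
    have "{e \<in> E1. v \<in> e} = {e \<in> E2. v \<in> e} \<union> {{w, v}, {b, v}}"
      using split[OF ne] E1_wb(2)[OF v] by auto
    moreover have "{e \<in> E2. v \<in> e} \<inter> {{w, v}, {b, v}} = {}" by (auto simp: E2_def)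
    moreover have "card {{w, v}, {b, v}} = 2" using wb(1) ne by (simp add: doubleton_eq_iff)
    ultimately have "degree E1 v = degree E2 v + 2"
      unfolding degree_def using card_Un_disjoint[OF fin[of v], of "{{w, v}, {b, v}}"] by simp
    then show ?thesis using degree_E1[of v] v by simp
  qed
  show "degree E2 v = 0" if v: "v \<notin> N \<union> C"
  proof -
    have "v \<in> {w, b} \<or> v \<notin> V" using v V_eq by auto
    then have none: "{e \<in> E2. v \<in> e} = {}" using EV by (auto simp: E2_def E1_def)
    show ?thesis unfolding degree_def none by simp
  qed
qed

lemma degree_E2_le: "degree E2 v + T \<le> k"
  using degree_E2[of v] size_bounds by (cases "v \<in> C"; cases "v \<in> N") auto

lemma full_E2: "degree E2 v + T = k \<Longrightarrow> v \<in> C"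
  using degree_E2[of v] size_bounds by (cases "v \<in> C"; cases "v \<in> N") auto

text \<open>The matchings that avoid \<open>w\<close> and \<open>b\<close> come back before these
  two vertices do, for without them the graph would not be regular. Then \<open>b\<close> and
  \<open>w\<close> are inserted, the latter by parity in the \<open>(k - q)\<close>-regular graph
  \<open>Es\<close>, and the perfect matchings come last.\<close>

lemma colorable_from_E2:
  assumes "edge_colorable (k - T) E2"
  shows "edge_colorable k E"
proof -
  note sb = size_bounds
  define Es where "Es = E - (\<Union>s\<in>{..<q}. F s)"
  define E4 where "E4 = {e \<in> Es. w \<notin> e}"
  have Es: "two_uniform Es" and E4: "two_uniform E4"
    using two_uniform_subset[OF E] by (auto simp: Es_def E4_def)
  have degEs: "degree Es v = k - q" if v: "v \<in> V" for v
  proof -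
    have "degree (E - (\<Union>s\<in>{..<q}. F s)) v + card {..<q} = degree E v"
      by (rule degree_minus_matchings[OF E]) (use F_sub F_pw F_cover F_disj v sb in auto)
    then show ?thesis using reg[OF v] by (simp add: Es_def)
  qed
  have deg0: "degree E4 v = 0" if "v \<notin> V" for v
  proof -
    have none: "{e \<in> E4. v \<in> e} = {}" using EV that by (auto simp: E4_def Es_def)
    show ?thesis unfolding degree_def none by simp
  qed
  have deg_le: "degree E4 v \<le> k - q" for v
    using degree_mono[OF Es, of E4 v] degEs[of v] deg0[of v] by (cases "v \<in> V") (auto simp: E4_def)
  have w_drop: "degree E4 y < k - q" if y: "y \<in> N" for y
  proof -
    have yV: "y \<in> V" using y subsets by auto
    have "{w, y} \<in> E1" using E1_wb(2)[OF y] ..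
    then have "{w, y} \<in> Es" using sb(4) by (auto simp: E1_def Es_def)
    then have "degree E4 y < degree Es y"
      by (rule degree_less[OF Es, rotated]) (auto simp: E4_def)
    then show ?thesis using degEs[OF yV] by simp
  qed
  have bN: "y \<in> N" if y: "{b, y} \<in> E4" for y
  proof -
    have "{b, y} \<in> E" "y \<noteq> w" using y by (auto simp: E4_def Es_def)
    moreover from this have "y \<in> V" using EV by auto
    moreover have "y \<notin> Y"
    proof
      assume "y \<in> Y"
      then obtain s where s: "s < T" "{b, y} \<in> F s" using F_b by blast
      then have "s < q" using F_cover[OF s(1)] by (auto split: if_splits)
      then show False using s y by (auto simp: E4_def Es_def)
    qed
    ultimately show ?thesis
      using adjacent_iff[OF b, of y] by (auto simp: N_def C_def Y_def)
  qed
  have "edge_colorable (k - T + card {q..<T}) (E2 \<union> (\<Union>s\<in>{q..<T}. F s))"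
    using F_pw by (intro colorable_add_matchings assms) auto
  moreover have "k - T + card {q..<T} = k - q" using sb by simp
  moreover have "{e \<in> E4. b \<notin> e} \<subseteq> E2 \<union> (\<Union>s\<in>{q..<T}. F s)"
  proof
    fix e assume e: "e \<in> {e \<in> E4. b \<notin> e}"
    show "e \<in> E2 \<union> (\<Union>s\<in>{q..<T}. F s)"
    proof (cases "e \<in> E1")
      case False
      then obtain s where s: "s < T" "e \<in> F s" using e by (auto simp: E4_def Es_def E1_def)
      moreover have "q \<le> s" using e s by (auto simp: E4_def Es_def not_less[symmetric])
      ultimately show ?thesis by auto
    qed (use e in \<open>auto simp: E4_def E2_def\<close>)
  qed
  ultimately have E3: "edge_colorable (k - q) {e \<in> E4. b \<notin> e}"
    using edge_colorable_subset by metis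
  \<comment> \<open>Every neighbor of \<open>b\<close> lies in \<open>N\<close> and has lost its
    edge to \<open>w\<close>, so none is full and \<open>s = 0\<close> works. What remains to be
    counted are the full vertices, at most \<open>card C + 1\<close> because \<open>b\<close> may be
    one of them.\<close>
  have "edge_colorable (k - q) E4"
  proof (rule colorable_add_vertex[OF E4 deg_le E3, where s = 0])
    have none: "{z \<in> nbrs E4 b. degree E4 z = k - q} = {}" using bN w_drop by fastforce
    show "card {z \<in> nbrs E4 b. degree E4 z = k - q} \<le> 0" unfolding none by simp
    have none': "{y \<in> nbrs E4 b. k - q < degree E4 y + 0} = {}"
      using deg_le by (auto simp: not_less)
    have "{v \<in> \<Union>E4. degree E4 v = k - q} \<subseteq> insert b C"
    proof
      fix v assume v: "v \<in> {v \<in> \<Union>E4. degree E4 v = k - q}"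
      then have "v \<in> V" "v \<noteq> w" using EV by (auto simp: E4_def Es_def)
      moreover have "v \<notin> N" using w_drop[of v] v by auto
      ultimately show "v \<in> insert b C" using V_eq by auto
    qed
    then have "card {v \<in> \<Union>E4. degree E4 v = k - q} \<le> card (insert b C)"
      using finites by (intro card_mono) auto
    moreover have "card (insert b C) \<le> card C + 1" by (simp add: card_insert_if finites)
    ultimately show "card {y \<in> nbrs E4 b. k - q < degree E4 y + 0} +
        card {v \<in> \<Union>E4. degree E4 v = k - q} \<le> k - q"
      unfolding none' using sb high cardV by simp
  qed
  then have "edge_colorable (k - q) Es"
    using regular_colorable_add_vertex[OF finV evenV w Es _ degEs] EV by (auto simp: E4_def Es_def)
  then have "edge_colorable (k - q + card {..<q}) (Es \<union> (\<Union>s\<in>{..<q}. F s))"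
    using F_pw sb by (intro colorable_add_matchings) auto
  moreover have "E \<subseteq> Es \<union> (\<Union>s\<in>{..<q}. F s)" by (auto simp: Es_def)
  moreover have "k - q + card {..<q} = k" using sb by simp
  ultimately show ?thesis using edge_colorable_subset by metis
qed

lemma card_full_E2:
  assumes "H \<subseteq> E2"
  shows "card {v \<in> \<Union>H. degree H v = k - T} \<le> card C"
proof (rule card_mono[OF finites(1)])
  show "{v \<in> \<Union>H. degree H v = k - T} \<subseteq> C"
  proof
    fix v assume "v \<in> {v \<in> \<Union>H. degree H v = k - T}"
    then have "k - T \<le> degree E2 v" using degree_mono[OF two_uniform_sub(2) assms, of v] by simp
    then show "v \<in> C" using degree_E2_le[of v] size_bounds by (intro full_E2) simp
  qed
qed

lemma degree_E2_le_diff: "degree E2 v \<le> k - T"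
  using degree_E2_le[of v] by simp

lemma E2_mem: "{x, y} \<in> E2 \<Longrightarrow> x \<in> N \<union> C \<and> y \<in> N \<union> C"
proof -
  assume xy: "{x, y} \<in> E2"
  then have "{x, y} \<subseteq> V" using EV unfolding E2_def E1_def by blast
  with xy show ?thesis by (auto simp: E2_def N_def)
qed

text \<open>Here the full vertices themselves are deleted: only the other vertex of \<open>C\<close>
  can be a neighbor of degree above \<open>k - T - 2\<close>, so \<open>s = 2\<close> works.\<close>

lemma colorable_small:
  assumes "card C \<le> 2"
  shows "edge_colorable k E"
proof (rule colorable_from_E2, rule colorable_add_vertices[where s = 2])
  show "finite C" by (rule finites)
  show "two_uniform E2" by (rule two_uniform_sub)
  show "degree E2 v \<le> k - T" for v by (rule degree_E2_le_diff)
  fix a assume a: "a \<in> C"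
  have cC: "card (C - {a}) \<le> 1" using assms finites(1) a by simp
  have poor: "{y \<in> nbrs E2 a. k - T < degree E2 y + 2} \<subseteq> C - {a}"
  proof
    fix y assume y: "y \<in> {y \<in> nbrs E2 a. k - T < degree E2 y + 2}"
    then have "y \<in> N \<union> C" "y \<noteq> a" using E2_mem[of a y] two_uniform_neq[OF two_uniform_sub(2), of a y] by auto
    moreover have "y \<notin> N" using degree_E2(2)[of y] y size_bounds by auto
    ultimately show "y \<in> C - {a}" by auto
  qed
  have "{z \<in> nbrs E2 a. degree E2 z = k - T} \<subseteq> C - {a}"
    using poor size_bounds by auto
  then have "card {z \<in> nbrs E2 a. degree E2 z = k - T} \<le> card (C - {a})"
    using finites by (intro card_mono) auto
  then show "card {z \<in> nbrs E2 a. degree E2 z = k - T} \<le> 2" using cC by linarith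
  have "card {y \<in> nbrs E2 a. k - T < degree E2 y + 2} \<le> card (C - {a})"
    using finites poor by (intro card_mono) auto
  then show "card {y \<in> nbrs E2 a. k - T < degree E2 y + 2} +
      card {v \<in> \<Union>E2. degree E2 v = k - T} \<le> k - T"
    using cC card_full_E2[OF order_refl] assms size_bounds by linarith
next
  show "edge_colorable (k - T) {e \<in> E2. e \<inter> C = {}}" (is "edge_colorable _ ?H")
  proof (rule colorable_no_full_vertex)
    show H: "two_uniform ?H" using two_uniform_subset[OF two_uniform_sub(2)] by auto
    fix v
    show "degree ?H v < k - T"
    proof (cases "v \<in> C")
      case True
      then have none: "{e \<in> ?H. v \<in> e} = {}" by auto
      show ?thesis unfolding degree_def none using size_bounds by simp
    next
      case False
      then have "degree E2 v + T < k" using full_E2[of v] degree_E2_le[of v] by linarith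
      moreover have "degree ?H v \<le> degree E2 v" by (rule degree_mono[OF two_uniform_sub(2)]) auto
      ultimately show ?thesis by linarith
    qed
  qed
qed

text \<open>Deleting two vertices without neighbours in \<open>C\<close> leaves most other vertices with four colors
  to spare, so a vertex keeping at most four neighbours in \<open>C\<close> can be deleted next, and these
  neighbours are then no longer full.\<close>

lemma colorable_large:
  assumes P: "P \<subseteq> A" "card P = 2" "\<And>p. p \<in> P \<Longrightarrow> keep p = {}"
    and B: "B \<subseteq> A - P" "\<And>a. a \<in> B \<Longrightarrow> card (keep a \<inter> C) \<le> 4"
    and kept: "\<And>v. v \<in> C \<Longrightarrow> \<exists>a\<in>B. {a, v} \<in> E \<and> v \<in> keep a"
    and r: "3 * r + 2 * card C + 11 \<le> card V"
  shows "edge_colorable k E"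
proof -
  note sb = size_bounds
  have A: "A \<inter> C = {}" "A \<subseteq> N" using AN subsets by auto
  have finA: "finite A" using AN finites by (auto intro: finite_subset)
  have finP: "finite P" and finB: "finite B"
    using P(1) B(1) finA by (auto intro: finite_subset)
  have AC: "{a, v} \<in> E2 \<longleftrightarrow> {a, v} \<in> E \<and> v \<in> keep a" if "a \<in> A" "v \<in> C" for a v
  proof -
    have "a \<noteq> w" "a \<noteq> b" "v \<noteq> w" "v \<noteq> b" using that A subsets by auto
    then show ?thesis using F_A[OF that] by (auto simp: E2_def E1_def)
  qed
  define H where "H = {e \<in> E2. e \<inter> P = {}}"
  have sub: "H \<subseteq> E2" by (auto simp: H_def)
  have H: "two_uniform H" using two_uniform_subset[OF two_uniform_sub(2) sub] .
  have degH: "degree H v \<le> degree E2 v" for v by (rule degree_mono[OF two_uniform_sub(2) sub])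
  have colH: "edge_colorable (k - T) H"
  proof (rule colorable_add_vertices[OF finB H, where s = 4])
    show "degree H v \<le> k - T" for v using degH[of v] degree_E2_le_diff[of v] by simp
    fix a assume a: "a \<in> B"
    then have aA: "a \<in> A" "a \<in> N" using B(1) A by auto
    have nbC: "y \<in> keep a" if "{a, y} \<in> H" "y \<in> C" for y
      using AC[OF aA(1) that(2)] that(1) sub by auto
    have "{z \<in> nbrs H a. degree H z = k - T} \<subseteq> keep a \<inter> C"
    proof
      fix z assume z: "z \<in> {z \<in> nbrs H a. degree H z = k - T}"
      then have "degree E2 z + T = k" using degH[of z] degree_E2_le[of z] sb by auto
      then have "z \<in> C" by (rule full_E2)
      then show "z \<in> keep a \<inter> C" using nbC z by auto
    qed
    then have "card {z \<in> nbrs H a. degree H z = k - T} \<le> card (keep a \<inter> C)"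
      using finites by (intro card_mono) auto
    then show "card {z \<in> nbrs H a. degree H z = k - T} \<le> 4" using B(2)[OF a] by linarith
    \<comment> \<open>The vertices of \<open>N\<close> that lose no edge when \<open>p\<close> is
      deleted. All \<open>k - T - 2\<close> neighbors of \<open>p\<close> lie in \<open>N\<close>,
      which leaves \<open>card N - 1 - (k - T - 2) = r + 2\<close> vertices.\<close>
    define U where "U p = N - {p} - nbrs E2 p" for p
    have cU: "card (U p) \<le> r + 2" if p: "p \<in> P" for p
    proof -
      have pN: "p \<in> N" "p \<in> A" using p P(1) A by auto
      have pnb: "nbrs E2 p \<subseteq> N - {p}"
      proof
        fix y assume "y \<in> nbrs E2 p"
        then have y: "{p, y} \<in> E2" by simp
        then have "y \<notin> C" using AC[OF pN(2), of y] P(3)[OF p] by auto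
        then show "y \<in> N - {p}"
          using E2_mem[OF y] two_uniform_neq[OF two_uniform_sub(2) y] by auto
      qed
      have "card (U p) = card (N - {p}) - card (nbrs E2 p)"
        unfolding U_def by (rule card_Diff_subset[OF finite_nbrs[OF two_uniform_sub(2)] pnb])
      also have "card (N - {p}) = card N - 1" using pN finites by simp
      finally show ?thesis
        using degree_E2(2)[OF pN(1)] degree_eq_card_nbrs[OF two_uniform_sub(2), of p] sb cardV
        by (simp add: T_def)
    qed
    \<comment> \<open>A vertex of \<open>N\<close> starts at degree \<open>k - T - 2\<close>; if it
      is adjacent to both elements of \<open>P\<close>, it drops to \<open>k - T - 4\<close> and is
      not counted.\<close>
    have "{y \<in> nbrs H a. k - T < degree H y + 4} \<subseteq> (keep a \<inter> C) \<union> (\<Union>p\<in>P. U p)"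
    proof
      fix y assume y: "y \<in> {y \<in> nbrs H a. k - T < degree H y + 4}"
      then have aH: "{a, y} \<in> H" by simp
      then have "y \<in> N \<union> C" "y \<notin> P" using E2_mem[of a y] sub by (auto simp: H_def)
      show "y \<in> (keep a \<inter> C) \<union> (\<Union>p\<in>P. U p)"
      proof (cases "y \<in> C")
        case True
        then show ?thesis using nbC[OF aH] by simp
      next
        case False
        then have yN: "y \<in> N" using \<open>y \<in> N \<union> C\<close> by simp
        have "\<exists>p\<in>P. {p, y} \<notin> E2"
        proof (rule ccontr)
          assume "\<not> ?thesis"
          then have "{e \<in> H. y \<in> e} \<union> (\<lambda>p. {p, y}) ` P \<subseteq> {e \<in> E2. y \<in> e}" using sub by auto
          moreover have "finite {e \<in> E2. y \<in> e}"
            using two_uniform_sub(2) by (simp add: two_uniform_def)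
          ultimately have le: "card ({e \<in> H. y \<in> e} \<union> (\<lambda>p. {p, y}) ` P) \<le> degree E2 y"
            and fin: "finite {e \<in> H. y \<in> e}"
            unfolding degree_def by (auto intro: card_mono finite_subset)
          have "inj_on (\<lambda>p. {p, y}) P" by (auto simp: inj_on_def doubleton_eq_iff)
          then have "card ((\<lambda>p. {p, y}) ` P) = 2" using P(2) by (simp add: card_image)
          moreover have "{e \<in> H. y \<in> e} \<inter> (\<lambda>p. {p, y}) ` P = {}" by (auto simp: H_def)
          ultimately have "degree H y + 2 \<le> degree E2 y"
            using card_Un_disjoint[of "{e \<in> H. y \<in> e}" "(\<lambda>p. {p, y}) ` P"] fin finP le
            by (simp add: degree_def)
          then show False using degree_E2(2)[OF yN] y by auto
        qed
        then show ?thesis using yN \<open>y \<notin> P\<close> by (auto simp: U_def)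
      qed
    qed
    then have "card {y \<in> nbrs H a. k - T < degree H y + 4} \<le> card ((keep a \<inter> C) \<union> (\<Union>p\<in>P. U p))"
      using finites finP by (intro card_mono) (auto simp: U_def)
    also have "\<dots> \<le> card (keep a \<inter> C) + card (\<Union>p\<in>P. U p)" by (rule card_Un_le)
    also have "\<dots> \<le> 4 + (\<Sum>p\<in>P. r + 2)"
      using B(2)[OF a] order_trans[OF card_UN_le[OF finP] sum_mono[OF cU]] by (intro add_mono) auto
    also have "\<dots> = 2 * r + 8" using P(2) by simp
    \<comment> \<open>With \<open>T\<close> and \<open>k\<close> inserted,
      \<open>2 r + 8 + card C \<le> k - T\<close> becomes
      \<open>3 * r + 2 * card C + 11 \<le> card V\<close>.\<close>
    finally show "card {y \<in> nbrs H a. k - T < degree H y + 4} +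
        card {v \<in> \<Union>H. degree H v = k - T} \<le> k - T"
      using card_full_E2[OF sub] r cardV by (simp add: T_def)
  next
    let ?G = "{e \<in> H. e \<inter> B = {}}"
    have Gsub: "?G \<subseteq> E2" using sub by auto
    show "edge_colorable (k - T) ?G"
    proof (rule colorable_no_full_vertex)
      show "two_uniform ?G" using two_uniform_subset[OF two_uniform_sub(2) Gsub] .
      fix v
      have le: "degree ?G v \<le> degree E2 v" by (rule degree_mono[OF two_uniform_sub(2) Gsub])
      show "degree ?G v < k - T"
      proof (cases "v \<in> C")
        case True
        then obtain a where a: "a \<in> B" "{a, v} \<in> E" "v \<in> keep a" using kept by blast
        then have "{a, v} \<in> E2" using AC[of a v] True B(1) by auto
        then have "degree ?G v < degree E2 v"
          by (rule degree_less[OF two_uniform_sub(2) Gsub]) (use a in auto)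
        then show ?thesis using degree_E2_le[of v] by linarith
      next
        case False
        then have "degree E2 v + T < k" using full_E2[of v] degree_E2_le[of v] by linarith
        then show ?thesis using le by linarith
      qed
    qed
  qed
  have "edge_colorable (k - T) E2"
  proof (rule colorable_add_vertices[OF finP two_uniform_sub(2), where s = 0])
    show "degree E2 v \<le> k - T" for v by (rule degree_E2_le_diff)
    show "edge_colorable (k - T) {e \<in> E2. e \<inter> P = {}}" using colH by (simp add: H_def)
    fix a assume a: "a \<in> P"
    then have aA: "a \<in> A" using P(1) by auto
    have none: "{z \<in> nbrs E2 a. degree E2 z = k - T} = {}"
    proof (rule ccontr)
      assume "\<not> ?thesis"
      then obtain z where z: "{a, z} \<in> E2" "degree E2 z = k - T" by auto
      then have "z \<in> C" using full_E2[of z] sb by simp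
      then show False using AC[OF aA, of z] z(1) P(3)[OF a] by simp
    qed
    show "card {z \<in> nbrs E2 a. degree E2 z = k - T} \<le> 0" unfolding none by simp
    have none': "{y \<in> nbrs E2 a. k - T < degree E2 y + 0} = {}"
      using degree_E2_le_diff by (auto simp: not_less)
    show "card {y \<in> nbrs E2 a. k - T < degree E2 y + 0} +
        card {v \<in> \<Union>E2. degree E2 v = k - T} \<le> k - T"
      unfolding none' using card_full_E2[OF order_refl] r cardV by (simp add: T_def)
  qed
  then show ?thesis by (rule colorable_from_E2)
qed

end

section \<open>Choosing the vertices that keep edges to \<open>C\<close>\<close>

context twin_pair
begin

text \<open>\<open>C\<close> is cut into \<open>m\<close> blocks of at most four vertices. Since
  every vertex has \<open>r\<close> nonneighbors, at least \<open>card N - 4 * r\<close> vertices of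
  \<open>N\<close> are adjacent to a whole block, enough for distinct choices;
  \<open>\<kappa>\<close> maps a vertex to the choice for its block. Blocks \<open>m\<close> and
  \<open>m + 1\<close> are empty, and their representatives form \<open>P\<close>.\<close>

lemma keepers:
  assumes "3 \<le> card C"
  obtains \<kappa> P where "\<And>v. v \<in> C \<Longrightarrow> \<kappa> v \<in> N \<and> {\<kappa> v, v} \<in> E" "P \<subseteq> N" "card P = 2"
    "P \<inter> \<kappa> ` C = {}" "\<And>a. card {v \<in> C. \<kappa> v = a} \<le> 4"
    "card (\<kappa> ` C \<union> P) \<le> card C" "2 * (card (\<kappa> ` C \<union> P) + r + card C + 3) \<le> card V"
proof -
  obtain cp: "r \<ge> 1" "q + 1 \<le> r" "card C + 1 = r + q" "card N + card C + 2 = card V"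
    by (rule card_parts)
  obtain u where u: "bij_betw u {..<card C} C" using leaf_enumeration by metis
  define m where "m = (card C + 3) div 4"
  have m: "4 * m \<le> card C + 3" "card C \<le> 4 * m" by (auto simp: m_def)
  define bl where "bl j = {i. 4 * j \<le> i \<and> i < 4 * j + 4 \<and> i < card C}" for j
  have bl: "finite (bl j)" "card (bl j) \<le> 4" for j
  proof -
    have "bl j \<subseteq> {4 * j..<4 * j + 4}" by (auto simp: bl_def)
    then show "finite (bl j)" "card (bl j) \<le> 4"
      using card_mono[of "{4 * j..<4 * j + 4}" "bl j"] by (auto intro: finite_subset)
  qed
  define S where "S j = {a \<in> N. \<forall>i\<in>bl j. {a, u i} \<in> E}" for j
  have uC: "u i \<in> C" if "i < card C" for i using bij_betwE[OF u] that by auto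
  have "\<exists>g. inj_on g {..<m + 2} \<and> (\<forall>j\<in>{..<m + 2}. g j \<in> S j)"
  proof (rule greedy_representatives)
    fix j
    have "N \<subseteq> S j \<union> (\<Union>i\<in>bl j. non (u i))"
      using subsets(2,7) uC by (auto simp: S_def bl_def non_def insert_commute)
    then have "card N \<le> card (S j \<union> (\<Union>i\<in>bl j. non (u i)))"
      using finites finite_non bl(1) by (intro card_mono) (auto simp: S_def)
    also have "\<dots> \<le> card (S j) + card (\<Union>i\<in>bl j. non (u i))" by (rule card_Un_le)
    also have "card (\<Union>i\<in>bl j. non (u i)) \<le> (\<Sum>i\<in>bl j. card (non (u i)))"
      by (rule card_UN_le[OF bl(1)])
    also have "\<dots> = (\<Sum>i\<in>bl j. r)"
      using uC subsets(1) by (intro sum.cong card_non) (auto simp: bl_def)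
    also have "\<dots> \<le> 4 * r" using bl(2)[of j] by simp
    finally have "card N \<le> card (S j) + 4 * r" by simp
    then show "finite (S j) \<and> card {..<m + 2} \<le> card (S j)"
      using m(1) cp high finites by (simp add: S_def)
  qed simp
  then obtain g where g: "inj_on g {..<m + 2}" "\<And>j. j < m + 2 \<Longrightarrow> g j \<in> S j" by auto
  define ix where "ix = inv_into {..<card C} u"
  have ix: "ix v < card C" "u (ix v) = v" if "v \<in> C" for v
    using bij_betw_inv_into_right[OF u that] bij_betwE[OF bij_betw_inv_into[OF u]] that
    by (auto simp: ix_def)
  define \<kappa> where "\<kappa> v = g (ix v div 4)" for v
  define P where "P = g ` {m, m + 1}"
  have ixm: "ix v div 4 < m" if "v \<in> C" for v using ix(1)[OF that] m(2) by auto
  have \<kappa>sub: "\<kappa> ` C \<subseteq> g ` {..<m}" using ixm by (auto simp: \<kappa>_def)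
  have 1: "\<kappa> v \<in> N \<and> {\<kappa> v, v} \<in> E" if v: "v \<in> C" for v
  proof -
    have "\<kappa> v \<in> S (ix v div 4)" using g(2) ixm[OF v] by (simp add: \<kappa>_def)
    moreover have "ix v \<in> bl (ix v div 4)" using ix(1)[OF v] by (auto simp: bl_def)
    ultimately show ?thesis using ix(2)[OF v] by (auto simp: S_def)
  qed
  have 2: "P \<subseteq> N" using g(2) by (auto simp: P_def S_def)
  have 3: "card P = 2"
  proof -
    have "inj_on g {m, m + 1}" using g(1) by (rule inj_on_subset) auto
    then show ?thesis by (simp add: P_def card_image)
  qed
  have 4: "P \<inter> \<kappa> ` C = {}"
  proof -
    have "g ` {m, m + 1} \<inter> g ` {..<m} = g ` ({m, m + 1} \<inter> {..<m})"
      using g(1) by (intro inj_on_image_Int[symmetric]) auto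
    then show ?thesis using \<kappa>sub by (auto simp: P_def)
  qed
  have 5: "card {v \<in> C. \<kappa> v = a} \<le> 4" for a
  proof (cases "\<exists>v0\<in>C. \<kappa> v0 = a")
    case True
    then obtain v0 where v0: "v0 \<in> C" "\<kappa> v0 = a" by blast
    have "{v \<in> C. \<kappa> v = a} \<subseteq> u ` bl (ix v0 div 4)"
    proof
      fix v assume v: "v \<in> {v \<in> C. \<kappa> v = a}"
      then have "g (ix v div 4) = g (ix v0 div 4)" using v0 by (simp add: \<kappa>_def)
      then have "ix v div 4 = ix v0 div 4"
        using inj_onD[OF g(1)] ixm[of v] ixm[of v0] v v0 by simp
      then have "ix v \<in> bl (ix v0 div 4)" using ix(1)[of v] v by (auto simp: bl_def)
      then show "v \<in> u ` bl (ix v0 div 4)" using ix(2)[of v] v by (metis (mono_tags, lifting) CollectD imageI)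
    qed
    then have "card {v \<in> C. \<kappa> v = a} \<le> card (u ` bl (ix v0 div 4))"
      using bl(1) by (intro card_mono) auto
    also have "\<dots> \<le> 4" using card_image_le[OF bl(1)] bl(2) le_trans by blast
    finally show ?thesis .
  next
    case False
    then have none: "{v \<in> C. \<kappa> v = a} = {}" by auto
    show ?thesis unfolding none by simp
  qed
  have "\<kappa> ` C \<union> P \<subseteq> g ` {..<m + 2}" using \<kappa>sub by (auto simp: P_def)
  then have "card (\<kappa> ` C \<union> P) \<le> card (g ` {..<m + 2})" by (intro card_mono) auto
  also have "\<dots> \<le> m + 2" using card_image_le[of "{..<m + 2}" g] by simp
  finally have cA: "card (\<kappa> ` C \<union> P) \<le> m + 2" .
  have "m + 2 \<le> card C" using assms by (simp add: m_def)
  moreover have "2 * (m + 2 + r + card C + 3) \<le> card V" using m(1) cp high by simp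
  ultimately show thesis using that[of \<kappa> P] 1 2 3 4 5 cA by simp
qed

lemma colorable: "edge_colorable k E"
proof -
  obtain cp: "r \<ge> 1" "q + 1 \<le> r" "card C + 1 = r + q" "card N + card C + 2 = card V"
    by (rule card_parts)
  show ?thesis
  proof (cases "card C \<le> 2")
    case True
    \<comment> \<open>With at most two vertices in \<open>C\<close>, the set \<open>P\<close> and
      the keepers would outnumber \<open>C\<close>, and \<open>peel\<close> would run out of
      indices.\<close>
    have empty: "{} \<subseteq> N" "card ({} :: 'a set) \<le> card C"
      "2 * (card ({} :: 'a set) + r + card C + 3) \<le> card V" using cp high True by simp_all
    obtain F where "\<And>s. s < T \<Longrightarrow> F s \<subseteq> E" "\<And>s. s < T \<Longrightarrow> pairwise disjnt (F s)"
      "\<And>s. s < T \<Longrightarrow> \<Union>(F s) = (if s < q then V else V - {w, b})"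
      "\<And>s s'. s < T \<Longrightarrow> s' < T \<Longrightarrow> s \<noteq> s' \<Longrightarrow> F s \<inter> F s' = {}"
      "\<And>v. (\<exists>s<T. {w, v} \<in> F s) \<longleftrightarrow> v \<in> X" "\<And>v. (\<exists>s<T. {b, v} \<in> F s) \<longleftrightarrow> v \<in> Y"
      by (rule peel[OF empty, of "\<lambda>_. {}"]) blast
    then interpret peeled V E k r w b "{}" "\<lambda>_. {}" F by unfold_locales auto
    show ?thesis by (rule colorable_small[OF True])
  next
    case False
    then have "3 \<le> card C" by simp
    then obtain \<kappa> P where k: "\<And>v. v \<in> C \<Longrightarrow> \<kappa> v \<in> N \<and> {\<kappa> v, v} \<in> E" "P \<subseteq> N" "card P = 2"
      "P \<inter> \<kappa> ` C = {}" "\<And>a. card {v \<in> C. \<kappa> v = a} \<le> 4"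
      "card (\<kappa> ` C \<union> P) \<le> card C" "2 * (card (\<kappa> ` C \<union> P) + r + card C + 3) \<le> card V"
      by (rule keepers) blast
    define keep where "keep a = {v \<in> C. \<kappa> v = a}" for a
    have AN: "\<kappa> ` C \<union> P \<subseteq> N" using k(1,2) by auto
    obtain F where "\<And>s. s < T \<Longrightarrow> F s \<subseteq> E" "\<And>s. s < T \<Longrightarrow> pairwise disjnt (F s)"
      "\<And>s. s < T \<Longrightarrow> \<Union>(F s) = (if s < q then V else V - {w, b})"
      "\<And>s s'. s < T \<Longrightarrow> s' < T \<Longrightarrow> s \<noteq> s' \<Longrightarrow> F s \<inter> F s' = {}"
      "\<And>v. (\<exists>s<T. {w, v} \<in> F s) \<longleftrightarrow> v \<in> X" "\<And>v. (\<exists>s<T. {b, v} \<in> F s) \<longleftrightarrow> v \<in> Y"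
      "\<And>a v. a \<in> \<kappa> ` C \<union> P \<Longrightarrow> v \<in> C \<Longrightarrow> {a, v} \<in> E \<Longrightarrow>
        (\<exists>s<T. {a, v} \<in> F s) \<longleftrightarrow> v \<notin> keep a"
      by (rule peel[OF AN k(6,7), of keep]) blast
    then interpret peeled V E k r w b "\<kappa> ` C \<union> P" keep F using AN by unfold_locales
    show ?thesis
    proof (rule colorable_large[of P "\<kappa> ` C"])
      show "P \<subseteq> \<kappa> ` C \<union> P" "card P = 2" "\<kappa> ` C \<subseteq> \<kappa> ` C \<union> P - P" using k(3,4) by auto
      show "keep p = {}" if "p \<in> P" for p using that k(4) by (auto simp: keep_def)
      have "keep a \<inter> C = {v \<in> C. \<kappa> v = a}" for a by (auto simp: keep_def)
      then show "card (keep a \<inter> C) \<le> 4" for a using k(5)[of a] by simp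
      show "\<exists>a\<in>\<kappa> ` C. {a, v} \<in> E \<and> v \<in> keep a" if "v \<in> C" for v
        using k(1)[OF that] that by (auto simp: keep_def)
      \<comment> \<open>By \<open>card C \<le> 2 r - 2\<close> the left-hand side is at most
        \<open>7 (r + 1)\<close>.\<close>
      show "3 * r + 2 * card C + 11 \<le> card V" using cp high by simp
    qed
  qed
qed

end

section \<open>Dense regular graphs of even order\<close>

lemma regular_high_degree_colorable:
  assumes V: "finite V" "even (card V)" "V \<noteq> {}"
    and E: "two_uniform E" "\<Union>E \<subseteq> V" and reg: "\<And>v. v \<in> V \<Longrightarrow> degree E v = k"
    and high: "6 * card V \<le> 7 * k"
  shows "edge_colorable k E"
proof -
  obtain w where w: "w \<in> V" using V(3) by blast
  have nw: "nbrs E w \<subseteq> V - {w}"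
  proof
    fix u assume "u \<in> nbrs E w"
    then have "{w, u} \<in> E" by simp
    then show "u \<in> V - {w}" using E(2) two_uniform_neq[OF E(1), of w u] by blast
  qed
  have cn: "card (nbrs E w) = k" using reg[OF w] degree_eq_card_nbrs[OF E(1)] by simp
  have Vw: "card V = Suc (card (V - {w}))" using V(1) w by (rule card.remove)
  then have "k + 1 \<le> card V" using card_mono[OF _ nw] V(1) cn by simp
  then obtain r where r: "card V = k + r + 1" by (metis add.assoc add.commute le_Suc_ex)
  show ?thesis
  proof (cases "nbrs E w = V - {w}")
    case False
    with nw have "\<not> V - {w} \<subseteq> nbrs E w" by blast
    then obtain b where b: "b \<in> V" "w \<noteq> b" "{w, b} \<notin> E" by fastforce
    interpret twin_pair V E k r w b
      using V E reg r w b high by unfold_locales auto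
    show ?thesis by (rule colorable)
  next
    \<comment> \<open>The graph is complete, and deleting \<open>w\<close> lowers every other degree
      below \<open>k\<close>.\<close>
    case True
    define E' where "E' = {e \<in> E. w \<notin> e}"
    have sub: "E' \<subseteq> E" by (auto simp: E'_def)
    have "degree E' v < k" for v
    proof (cases "v \<in> V \<and> v \<noteq> w")
      case False
      then have none: "{e \<in> E'. v \<in> e} = {}" using E(2) by (auto simp: E'_def)
      show ?thesis unfolding degree_def none using high V by (cases k) auto
    next
      case v: True
      then have "v \<in> nbrs E w" unfolding True by simp
      then have "{w, v} \<in> E" by simp
      then have "degree E' v < degree E v"
        by (rule degree_less[OF E(1) sub]) (auto simp: E'_def)
      then show ?thesis using reg v by simp
    qed
    then have "edge_colorable k E'"
      using two_uniform_subset[OF E(1) sub] by (rule colorable_no_full_vertex[rotated])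
    then show ?thesis
      using regular_colorable_add_vertex[OF V(1,2) w E reg] by (simp add: E'_def)
  qed
qed

theorem theorem4:
  fixes V :: "'a set" and E :: "'a set set" and k :: nat
  assumes "simple_graph V E"
    and "connected_graph V E"
    and "regular k V E"
    and "even (card V)"
    and "real k \<ge> 6 / 7 * real (card V)"
  shows "rd V E = k"
proof -
  have V: "finite V" "V \<noteq> {}"
    using assms(1,2) by (auto simp: simple_graph_def connected_graph_def)
  note E = two_uniform_simple_graph[OF assms(1)]
  have reg: "degree E v = k" if "v \<in> V" for v using assms(3) that by (simp add: regular_def)
  have "real (6 * card V) \<le> real (7 * k)" using assms(5) by simp
  then have high: "6 * card V \<le> 7 * k" by (simp only: of_nat_le_iff)
  have "card V \<noteq> 0" using V by simp
  then have "2 \<le> card V" using assms(4) by presburger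
  then show ?thesis
    using regular_high_degree_colorable[OF V(1) assms(4) V(2) E reg high] high
    by (intro rd_regular_eq[OF V(1) _ _ E reg]) auto
qed

end
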